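(* Let $2<p\le 1+\frac{2^*}{2}$ (with $p<\infty$). For any $a\in\mathbb R$, let $J^a=\{w\in H^1_{\Gamma_0}(\Omega): J(w)=a\}$. Then $J^a\cap\mathcal B_2\neq\emptyset$, where \[\mathcal B_2=\Big\{w\in H^1_{\Gamma_0}(\Omega): J(w)<\frac{p-2}{2p(S_1+S_2)}\big(\|w\|_2^2+\|w\|_{2,\Gamma_1}^2\big)\Big\}.\]
   Context: $\Omega\subset\mathbb R^n$ ($n\ge1$) is a (nonempty) bounded open set with $C^1$ boundary, $\partial\Omega=\Gamma_0\cup\Gamma_1$ is a partition into measurable sets with $\overline{\Gamma_0}\cap\overline{\Gamma_1}=\emptyset$, $\sigma$ is the $(n-1)$-dimensional surface measure, and $\sigma(\Gamma_0)>0$. $2^*=\frac{2n}{n-2}$ if $n\ge3$, $2^*=\infty$ if $n=1,2$. $\|\cdot\|_q$, $\|\cdot\|_{q,\Gamma_1}$ are the norms of $L^q(\Omega)$, $L^q(\Gamma_1)$. $H^1_{\Gamma_0}(\Omega)=\{w\in H^1(\Omega): w|_{\Gamma_0}=0\}$ (trace sense). Standing fact: since $\sigma(\Gamma_0)>0$, a Poincaré-type inequality holds, so $\|\nabla w\|_2$ is a norm on $H^1_{\Gamma_0}(\Omega)$ equivalent to the $H^1$ norm, and the following constants are finite: \[S_1=\sup_{w\in H^1_{\Gamma_0}(\Omega),\,w\ne0}\frac{\|w\|_{2,\Gamma_1}^2}{\|\nabla w\|_2^2},\qquad S_2=\sup_{w\in H^1_{\Gamma_0}(\Omega),\,w\ne0}\frac{\|w\|_2^2}{\|\nabla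 w\|_2^2}.\] $J(w)=\frac12\|\nabla w\|_2^2-\frac1p\|w\|_p^p$ for $w\in H^1_{\Gamma_0}(\Omega)$. *)

theory Defs
  imports "HOL-Analysis.Analysis"
begin

primrec Ck :: "nat \<Rightarrow> ('a::euclidean_space \<Rightarrow> real) \<Rightarrow> bool" where
  "Ck 0 f \<longleftrightarrow> continuous_on UNIV f"
| "Ck (Suc k) f \<longleftrightarrow> f differentiable_on UNIV \<and>
     (\<forall>i\<in>Basis. Ck k (\<lambda>x. frechet_derivative f (at x) i))"

definition test_function :: "'a::euclidean_space set \<Rightarrow> ('a \<Rightarrow> real) \<Rightarrow> bool" where
  "test_function \<Omega> \<phi> \<longleftrightarrow>
     (\<forall>k. Ck k \<phi>) \<and> compact (closure {x. \<phi> x \<noteq> 0}) \<and> closure {x. \<phi> x \<noteq> 0} \<subseteq> \<Omega>"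

text \<open>
  In suitable orthonormal coordinates near a boundary point, with \<open>e\<close> the last coordinate direction,
  \<open>\<Omega>\<close> is the set above the graph of a \<open>C\<^sup>1\<close> function of the other coordinates; the latter are
  encoded as the projection \<open>y - (y \<bullet> e) *\<^sub>R e\<close> of \<open>y\<close> to the hyperplane orthogonal to \<open>e\<close>.
  In dimension one this projection is \<open>0\<close>, and \<open>\<Omega>\<close> is locally a half-line.
\<close>

definition C1_boundary :: "'a::euclidean_space set \<Rightarrow> bool" where
  "C1_boundary \<Omega> \<longleftrightarrow> (\<forall>x\<in>frontier \<Omega>. \<exists>r>0. \<exists>e \<gamma>. norm e = 1 \<and> Ck 1 \<gamma> \<and>
     \<Omega> \<inter> ball x r = {y \<in> ball x r. \<gamma> (y - (y \<bullet> e) *\<^sub>R e) < y \<bullet> e})"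

text \<open>
  The \<open>s\<close>-dimensional Hausdorff measure, normalised so that it agrees with \<open>s\<close>-dimensional surface
  measure on \<open>C\<^sup>1\<close> hypersurfaces. For \<open>s = 0\<close> a nonempty set contributes \<open>1\<close>, because \<open>0 ^ 0 = 1\<close>,
  and one obtains the counting measure. The boundedness condition is needed because
  \<^const>\<open>diameter\<close> is unspecified on unbounded sets.
\<close>

definition hausdorff_premeasure ::
  "nat \<Rightarrow> real \<Rightarrow> 'a::euclidean_space set \<Rightarrow> ennreal" where
  "hausdorff_premeasure s \<delta> A =
     (INF C \<in> {C :: nat \<Rightarrow> 'a set. A \<subseteq> (\<Union>i. C i) \<and> (\<forall>i. bounded (C i) \<and> diameter (C i) \<le> \<delta>)}.
        \<Sum>i. if C i = {} then 0 else ennreal (unit_ball_vol (real s) * (diameter (C i) / 2) ^ s))"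

definition hausdorff_outer_measure :: "nat \<Rightarrow> 'a::euclidean_space set \<Rightarrow> ennreal" where
  "hausdorff_outer_measure s A = (SUP \<delta>\<in>{0<..}. hausdorff_premeasure s \<delta> A)"

definition hausdorff_measure :: "nat \<Rightarrow> 'a::euclidean_space measure" where
  "hausdorff_measure s = measure_of UNIV
     (lambda_system UNIV UNIV (hausdorff_outer_measure s)) (hausdorff_outer_measure s)"

definition surface_measure :: "'a::euclidean_space set \<Rightarrow> 'a measure" where
  "surface_measure \<Omega> = restrict_space (hausdorff_measure (DIM('a) - 1)) (frontier \<Omega>)"

text \<open>
  Elements of these spaces are represented by functions; equality in them is equality almost
  everywhere, and only the values on the underlying set matter.
\<close>

definition Lp_space :: "real \<Rightarrow> 'a measure \<Rightarrow> ('a \<Rightarrow> 'b::euclidean_space) set" where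
  "Lp_space q M = {f \<in> borel_measurable M. integrable M (\<lambda>x. norm (f x) powr q)}"

definition Lp_norm :: "real \<Rightarrow> 'a measure \<Rightarrow> ('a \<Rightarrow> 'b::euclidean_space) \<Rightarrow> real" where
  "Lp_norm q M f = (\<integral>x. norm (f x) powr q \<partial>M) powr (1 / q)"

definition locally_integrable ::
  "'a::euclidean_space set \<Rightarrow> ('a \<Rightarrow> 'b::euclidean_space) \<Rightarrow> bool" where
  "locally_integrable \<Omega> f \<longleftrightarrow> (\<forall>K. compact K \<and> K \<subseteq> \<Omega> \<longrightarrow> set_integrable lebesgue K f)"

definition has_weak_gradient ::
  "'a::euclidean_space set \<Rightarrow> ('a \<Rightarrow> real) \<Rightarrow> ('a \<Rightarrow> 'a) \<Rightarrow> bool" where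
  "has_weak_gradient \<Omega> w G \<longleftrightarrow> locally_integrable \<Omega> w \<and> locally_integrable \<Omega> G \<and>
     (\<forall>\<phi>. test_function \<Omega> \<phi> \<longrightarrow> (\<forall>i\<in>Basis.
        (\<integral>x. w x * frechet_derivative \<phi> (at x) i \<partial>lebesgue_on \<Omega>) =
        - (\<integral>x. (G x \<bullet> i) * \<phi> x \<partial>lebesgue_on \<Omega>)))"

definition weak_gradient :: "'a::euclidean_space set \<Rightarrow> ('a \<Rightarrow> real) \<Rightarrow> 'a \<Rightarrow> 'a" where
  "weak_gradient \<Omega> w = (SOME G. has_weak_gradient \<Omega> w G)"

definition H1 :: "'a::euclidean_space set \<Rightarrow> ('a \<Rightarrow> real) set" where
  "H1 \<Omega> = {w \<in> Lp_space 2 (lebesgue_on \<Omega>).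
     \<exists>G \<in> Lp_space 2 (lebesgue_on \<Omega>). has_weak_gradient \<Omega> w G}"

definition grad_norm :: "'a::euclidean_space set \<Rightarrow> ('a \<Rightarrow> real) \<Rightarrow> real" where
  "grad_norm \<Omega> w = Lp_norm 2 (lebesgue_on \<Omega>) (weak_gradient \<Omega> w)"

definition H1_norm :: "'a::euclidean_space set \<Rightarrow> ('a \<Rightarrow> real) \<Rightarrow> real" where
  "H1_norm \<Omega> w = sqrt ((Lp_norm 2 (lebesgue_on \<Omega>) w)\<^sup>2 + (grad_norm \<Omega> w)\<^sup>2)"

text \<open>
  The trace operator is the continuous extension to \<open>H\<^sup>1(\<Omega>)\<close> of the restriction
  \<open>u \<mapsto> u|\<^bsub>\<partial>\<Omega>\<^esub>\<close>, defined on the dense subspace of functions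
  in \<open>H\<^sup>1(\<Omega>)\<close> that are continuous up to the boundary. Traces are unique up to null sets.
\<close>

definition has_trace :: "'a::euclidean_space set \<Rightarrow> ('a \<Rightarrow> real) \<Rightarrow> ('a \<Rightarrow> real) \<Rightarrow> bool" where
  "has_trace \<Omega> w g \<longleftrightarrow> w \<in> H1 \<Omega> \<and> g \<in> Lp_space 2 (surface_measure \<Omega>) \<and>
     (\<exists>u :: nat \<Rightarrow> 'a \<Rightarrow> real.
        (\<forall>k. u k \<in> H1 \<Omega> \<and> continuous_on (closure \<Omega>) (u k)) \<and>
        (\<lambda>k. H1_norm \<Omega> (\<lambda>x. u k x - w x)) \<longlonglongrightarrow> 0 \<and>
        (\<lambda>k. Lp_norm 2 (surface_measure \<Omega>) (\<lambda>x. u k x - g x)) \<longlonglongrightarrow> 0)"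

definition trace :: "'a::euclidean_space set \<Rightarrow> ('a \<Rightarrow> real) \<Rightarrow> 'a \<Rightarrow> real" where
  "trace \<Omega> w = (SOME g. has_trace \<Omega> w g)"

definition H1_vanishing :: "'a::euclidean_space set \<Rightarrow> 'a set \<Rightarrow> ('a \<Rightarrow> real) set" where
  "H1_vanishing \<Omega> \<Gamma>\<^sub>0 = {w \<in> H1 \<Omega>.
     \<exists>g. has_trace \<Omega> w g \<and> (AE x in surface_measure \<Omega>. x \<in> \<Gamma>\<^sub>0 \<longrightarrow> g x = 0)}"

definition trace_norm :: "'a::euclidean_space set \<Rightarrow> 'a set \<Rightarrow> ('a \<Rightarrow> real) \<Rightarrow> real" where
  "trace_norm \<Omega> \<Gamma>\<^sub>1 w = Lp_norm 2 (restrict_space (surface_measure \<Omega>) \<Gamma>\<^sub>1) (trace \<Omega> w)"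

definition sobolev_exponent :: "nat \<Rightarrow> ereal" where
  "sobolev_exponent n = (if n \<ge> 3 then ereal (2 * real n / (real n - 2)) else \<infinity>)"

definition H1_vanishing_nonzero :: "'a::euclidean_space set \<Rightarrow> 'a set \<Rightarrow> ('a \<Rightarrow> real) set" where
  "H1_vanishing_nonzero \<Omega> \<Gamma>\<^sub>0 =
     {w \<in> H1_vanishing \<Omega> \<Gamma>\<^sub>0. \<not> (AE x in lebesgue_on \<Omega>. w x = 0)}"

text \<open>
  The suprema are taken in the extended reals, where \<open>a / 0 = \<infinity>\<close> for \<open>a > 0\<close>; hence
  \<open>S2 \<Omega> \<Gamma>\<^sub>0 < \<infinity>\<close> says exactly that the Poincare inequality holds on the space of
  functions vanishing on \<open>\<Gamma>\<^sub>0\<close>. This is not automatic when \<open>\<Gamma>\<^sub>0\<close> has positive measure: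
  \<open>\<Omega>\<close> may have a component whose boundary does not meet \<open>\<Gamma>\<^sub>0\<close>.
\<close>

definition S1 :: "'a::euclidean_space set \<Rightarrow> 'a set \<Rightarrow> 'a set \<Rightarrow> ereal" where
  "S1 \<Omega> \<Gamma>\<^sub>0 \<Gamma>\<^sub>1 = (SUP w \<in> H1_vanishing_nonzero \<Omega> \<Gamma>\<^sub>0.
     ereal ((trace_norm \<Omega> \<Gamma>\<^sub>1 w)\<^sup>2) / ereal ((grad_norm \<Omega> w)\<^sup>2))"

definition S2 :: "'a::euclidean_space set \<Rightarrow> 'a set \<Rightarrow> ereal" where
  "S2 \<Omega> \<Gamma>\<^sub>0 = (SUP w \<in> H1_vanishing_nonzero \<Omega> \<Gamma>\<^sub>0.
     ereal ((Lp_norm 2 (lebesgue_on \<Omega>) w)\<^sup>2) / ereal ((grad_norm \<Omega> w)\<^sup>2))"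

definition J :: "'a::euclidean_space set \<Rightarrow> real \<Rightarrow> ('a \<Rightarrow> real) \<Rightarrow> real" where
  "J \<Omega> p w = 1 / 2 * (grad_norm \<Omega> w)\<^sup>2 - 1 / p * Lp_norm p (lebesgue_on \<Omega>) w powr p"

definition J_level :: "'a::euclidean_space set \<Rightarrow> 'a set \<Rightarrow> real \<Rightarrow> real \<Rightarrow> ('a \<Rightarrow> real) set" where
  "J_level \<Omega> \<Gamma>\<^sub>0 p a = {w \<in> H1_vanishing \<Omega> \<Gamma>\<^sub>0. J \<Omega> p w = a}"

definition B2 :: "'a::euclidean_space set \<Rightarrow> 'a set \<Rightarrow> 'a set \<Rightarrow> real \<Rightarrow> ('a \<Rightarrow> real) set" where
  "B2 \<Omega> \<Gamma>\<^sub>0 \<Gamma>\<^sub>1 p = {w \<in> H1_vanishing \<Omega> \<Gamma>\<^sub>0.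
     J \<Omega> p w < (p - 2) / (2 * p * real_of_ereal (S1 \<Omega> \<Gamma>\<^sub>0 \<Gamma>\<^sub>1 + S2 \<Omega> \<Gamma>\<^sub>0)) *
       ((Lp_norm 2 (lebesgue_on \<Omega>) w)\<^sup>2 + (trace_norm \<Omega> \<Gamma>\<^sub>1 w)\<^sup>2)}"

end

theory Submission
  imports Defs
begin

text \<open>
  On the ray through a function \<open>v\<close> one has
  \<open>J (s v) = s\<^sup>2 / 2 \<parallel>\<nabla>v\<parallel>\<^sup>2 - s\<^sup>p / p \<parallel>v\<parallel>\<^sub>p\<^sup>p\<close>, which tends to \<open>- \<infinity>\<close> as
  \<open>s \<rightarrow> \<infinity>\<close> because \<open>p > 2\<close>. Fix a large \<open>s\<^sub>0\<close>. Multiplying a bump function by a rapidly oscillating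
  factor with values in \<open>[1, 3]\<close> yields \<open>v\<close> with \<open>\<parallel>\<nabla>v\<parallel>\<close> as large as desired, while \<open>\<parallel>v\<parallel>\<^sub>p\<close> stays bounded and
  \<open>\<parallel>v\<parallel>\<^sub>2\<close> stays bounded below; hence \<open>J (s\<^sub>0 v) \<ge> a\<close>, and \<open>J (s v) = a\<close> for some \<open>s \<ge> s\<^sub>0\<close>.
  For this \<open>s\<close> the norm \<open>\<parallel>s v\<parallel>\<^sub>2\<close> is at least a fixed multiple of \<open>s\<^sub>0\<close>, so \<open>s v\<close> lies in \<open>B2\<close>.
  Since \<open>v\<close> has compact support in \<open>\<Omega>\<close>, its trace plays no role.
\<close>

subsection \<open>Smooth bump functions\<close>

lemma Ck_Suc_differentiable: "Ck (Suc k) f \<Longrightarrow> f differentiable at x"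
  by (simp add: differentiable_on_eq_differentiable_at)

section \<open>Closure properties of smooth functions\<close>

lemma Ck_SucD: "Ck (Suc k) f \<Longrightarrow> Ck k f"
proof (induction k arbitrary: f)
  case 0
  then show ?case by (simp add: differentiable_imp_continuous_on)
qed simp

lemma Ck_continuous: "Ck k f \<Longrightarrow> continuous_on A f"
proof (induction k)
  case (Suc k)
  from Suc.IH[OF Ck_SucD[OF Suc.prems]] show ?case .
qed (auto intro: continuous_on_subset)

lemma frechet_derivative_unique:
  "(f has_derivative f') (at x) \<Longrightarrow> frechet_derivative f (at x) = f'"
  using frechet_derivative_at by metis

lemma Ck_SucI:
  assumes "\<And>x. (f has_derivative f' x) (at x)"
    and "\<And>i. i \<in> Basis \<Longrightarrow> Ck k (\<lambda>x. f' x i)"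
  shows "Ck (Suc k) f"
  using assms frechet_derivative_unique[OF assms(1)]
  by (auto simp: differentiable_on_eq_differentiable_at differentiable_def)

lemma Ck_Suc_has_derivative:
  "Ck (Suc k) f \<Longrightarrow> (f has_derivative frechet_derivative f (at x)) (at x)"
  using Ck_Suc_differentiable frechet_derivative_works by blast

lemma Ck_const: "Ck k (\<lambda>x. c)"
proof (induction k arbitrary: c)
  case (Suc k)
  show ?case by (rule Ck_SucI[where f' = "\<lambda>_ _. 0"]) (auto intro: Suc)
qed simp

lemma Ck_inner: "Ck k (\<lambda>x. x \<bullet> e)"
proof (cases k)
  case (Suc k)
  show ?thesis unfolding Suc
    by (rule Ck_SucI[where f' = "\<lambda>_ h. h \<bullet> e"]) (auto intro!: Ck_const derivative_eq_intros)
qed (auto intro!: continuous_intros)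

lemma Ck_add: "Ck k f \<Longrightarrow> Ck k g \<Longrightarrow> Ck k (\<lambda>x. f x + g x)"
proof (induction k arbitrary: f g)
  case (Suc k)
  show ?case
    by (rule Ck_SucI[OF has_derivative_add[OF Suc.prems[THEN Ck_Suc_has_derivative]]])
       (use Suc in auto)
qed (auto intro!: continuous_intros)

lemma Ck_mult: "Ck k f \<Longrightarrow> Ck k g \<Longrightarrow> Ck k (\<lambda>x. f x * g x)"
proof (induction k arbitrary: f g)
  case (Suc k)
  show ?case
    by (rule Ck_SucI[OF has_derivative_mult[OF Suc.prems[THEN Ck_Suc_has_derivative]]])
       (use Suc Suc.prems[THEN Ck_SucD] in \<open>auto intro!: Ck_add\<close>)
qed (auto intro!: continuous_intros)

lemma Ck_prod: "(\<And>i. i \<in> I \<Longrightarrow> Ck k (f i)) \<Longrightarrow> Ck k (\<lambda>x. \<Prod>i\<in>I. f i x)"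
  by (induction I rule: infinite_finite_induct) (auto intro: Ck_const Ck_mult)

text \<open>The outer function comes with its whole sequence of derivatives. Each use of the chain
  rule moves \<open>D j\<close> to \<open>D (Suc j)\<close>, so the induction on \<open>k\<close>
  generalises over \<open>j\<close>.\<close>

lemma Ck_compose:
  fixes D :: "nat \<Rightarrow> real \<Rightarrow> real"
  assumes D: "\<And>j t. (D j has_real_derivative D (Suc j) t) (at t)"
    and g: "\<And>k. Ck k g"
  shows "Ck k (\<lambda>x. D j (g x))"
proof (induction k arbitrary: j)
  case 0
  have "continuous_on UNIV (D j)"
    using D by (intro continuous_at_imp_continuous_on ballI DERIV_isCont)
  then show ?case
    using g[of 0] by (auto intro: continuous_on_compose2)
next
  case (Suc k)
  have "((\<lambda>x. D j (g x)) has_derivative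
      (\<lambda>h. D (Suc j) (g x) * frechet_derivative g (at x) h)) (at x)" for x
    using has_derivative_compose[OF Ck_Suc_has_derivative[OF g] D[unfolded has_field_derivative_def]]
    by simp
  then show ?case
    by (rule Ck_SucI) (use Suc g[of "Suc k"] in \<open>auto intro: Ck_mult\<close>)
qed

text \<open>Differentiation advances the phase of the sine by \<pi>/2, which puts all its
  derivatives into one indexed family of the kind \<open>Ck_compose\<close> expects. The index can
  also select a phase, and the oscillating factor uses it in this way.\<close>

lemma sin_derivatives:
  "((\<lambda>t. sin (t + real j * pi / 2)) has_real_derivative sin (t + real (Suc j) * pi / 2)) (at t)"
proof -
  have "sin (t + real (Suc j) * pi / 2) = sin ((t + real j * pi / 2) + pi / 2)"
    by (rule arg_cong[where f = sin]) (simp add: field_simps)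
  also have "\<dots> = cos (t + real j * pi / 2)"
    unfolding sin_add[of _ "pi / 2"] by simp
  finally have "sin (t + real (Suc j) * pi / 2) = cos (t + real j * pi / 2)" .
  then show ?thesis by (auto intro!: derivative_eq_intros)
qed

text \<open>
  \<open>flat j\<close> is the \<open>j\<close>-th derivative of the flat function equal to \<open>exp (- 1 / t)\<close> for \<open>t > 0\<close>;
  the recursion for \<open>flat_poly\<close> comes from differentiating \<open>p (1 / t) exp (- 1 / t)\<close>.
\<close>

primrec flat_poly :: "nat \<Rightarrow> real poly" where
  "flat_poly 0 = 1"
| "flat_poly (Suc j) = [:0, 0, 1:] * (flat_poly j - pderiv (flat_poly j))"

definition flat :: "nat \<Rightarrow> real \<Rightarrow> real" where
  "flat j t = (if t \<le> 0 then 0 else poly (flat_poly j) (1 / t) * exp (- 1 / t))"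

text \<open>Exponential decay beats every monomial. With y = 1/t this gives the vanishing of all
  derivatives of the flat function at 0.\<close>

lemma poly_exp_minus_tendsto_0: "((\<lambda>y. poly p y * exp (- y)) \<longlongrightarrow> (0::real)) at_top"
proof -
  have "((\<lambda>y. \<Sum>i\<le>degree p. coeff p i * (y ^ i / exp y)) \<longlongrightarrow> (\<Sum>i\<le>degree p. coeff p i * 0)) at_top"
    by (intro tendsto_intros tendsto_power_div_exp_0)
  then show ?thesis
    by (simp add: poly_altdef sum_distrib_right exp_minus divide_inverse mult.assoc)
qed

lemma flat_derivative: "(flat j has_real_derivative flat (Suc j) t) (at t)"
proof -
  consider "t < 0" | "t > 0" | "t = 0" by linarith
  then show ?thesis
  proof cases
    case 1
    then have "((\<lambda>_. 0) has_real_derivative flat (Suc j) t) (at t)"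
      by (simp add: flat_def)
    then show ?thesis
      by (rule has_field_derivative_transform_within_open[where S = "{..<0}"])
         (use 1 in \<open>auto simp: flat_def\<close>)
  next
    case 2
    have "((\<lambda>t. poly (flat_poly j) (1 / t) * exp (- 1 / t)) has_real_derivative flat (Suc j) t) (at t)"
      using 2
      by (auto intro!: derivative_eq_intros poly_DERIV[THEN DERIV_chain2]
          simp: flat_def field_simps power2_eq_square)
    then show ?thesis
      by (rule has_field_derivative_transform_within_open[where S = "{0<..}"])
         (use 2 in \<open>auto simp: flat_def\<close>)
  next
    case 3
    \<comment> \<open>With y = 1/t the right difference quotient at 0 is y q(y) exp(-y), where q is
      \<open>flat_poly j\<close>. The factor \<open>[:0, 1:]\<close> accounts for the division by
      t.\<close>
    have "((\<lambda>y. poly ([:0, 1:] * flat_poly j) y * exp (- y)) \<longlongrightarrow> 0) at_top"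
      by (rule poly_exp_minus_tendsto_0)
    then have "((\<lambda>t. poly ([:0, 1:] * flat_poly j) (inverse t) * exp (- inverse t)) \<longlongrightarrow> 0) (at_right 0)"
      by (rule filterlim_compose[OF _ filterlim_inverse_at_top_right])
    then have r: "((\<lambda>t. (flat j t - flat j 0) / (t - 0)) \<longlongrightarrow> 0) (at_right 0)"
      by (rule Lim_transform_eventually)
         (auto simp: flat_def field_simps eventually_at_right_field intro!: exI[of _ 1])
    have l: "((\<lambda>t. (flat j t - flat j 0) / (t - 0)) \<longlongrightarrow> 0) (at_left 0)"
      by (rule Lim_transform_eventually[OF tendsto_const])
         (auto simp: flat_def eventually_at_left_field intro!: exI[of _ "-1"])
    show ?thesis
      using l r unfolding 3 has_field_derivative_iff 
      by (simp add: filterlim_at_split) (simp add: flat_def)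
  qed
qed

lemma flat_0: "flat 0 t = (if t \<le> 0 then 0 else exp (- 1 / t))"
  by (simp add: flat_def)

text \<open>There is one factor for each face of the box. Inside, a factor equals exp(-1/(n c)) with
  c the distance to its face, so increasing the scale n drives the product to the indicator of the
  open box. The affine arguments are written as sums of products so that \<open>Ck_add\<close>,
  \<open>Ck_mult\<close>, \<open>Ck_inner\<close> and \<open>Ck_const\<close> apply
  directly.\<close>

definition box_bump :: "'a::euclidean_space \<Rightarrow> 'a \<Rightarrow> real \<Rightarrow> 'a \<Rightarrow> real" where
  "box_bump a b n x =
     (\<Prod>i\<in>Basis. flat 0 (n * (x \<bullet> i) + - n * (a \<bullet> i)) * flat 0 (- n * (x \<bullet> i) + n * (b \<bullet> i)))"

lemma Ck_box_bump: "Ck k (box_bump a b n)"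
  unfolding box_bump_def[abs_def]
  by (intro Ck_prod Ck_mult Ck_compose[where D = flat] flat_derivative Ck_add Ck_inner Ck_const)

lemma box_bump_bounds: "0 \<le> box_bump a b n x" "box_bump a b n x \<le> 1"
  unfolding box_bump_def
  by (auto simp: flat_0 intro!: prod_nonneg prod_le_1 mult_le_one)

lemma box_bump_nonzero_iff: "n > 0 \<Longrightarrow> box_bump a b n x \<noteq> 0 \<longleftrightarrow> x \<in> box a b"
proof -
  assume "n > 0"
  then have "n * (x \<bullet> i) + - n * (a \<bullet> i) > 0 \<longleftrightarrow> a \<bullet> i < x \<bullet> i"
    "- n * (x \<bullet> i) + n * (b \<bullet> i) > 0 \<longleftrightarrow> x \<bullet> i < b \<bullet> i" for i
    by auto
  then show ?thesis
    by (auto simp: box_bump_def flat_0 mem_box not_le)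
qed

lemma box_bump_tendsto: "(\<lambda>n. box_bump a b (real (Suc n)) x) \<longlonglongrightarrow> indicator (box a b) x"
proof (cases "x \<in> box a b")
  case True
  have lim: "(\<lambda>n. flat 0 (real (Suc n) * c)) \<longlonglongrightarrow> 1" if "c > 0" for c
  proof -
    have "(\<lambda>n. exp (- 1 / c * inverse (real (Suc n)))) \<longlonglongrightarrow> exp (-1 / c * 0)"
      by (intro tendsto_intros LIMSEQ_inverse_real_of_nat)
    moreover have "flat 0 (real (Suc n) * c) = exp (- 1 / c * inverse (real (Suc n)))" for n
      using that by (simp add: flat_0 mult_le_0_iff field_simps del: of_nat_Suc)
    ultimately show ?thesis by simp
  qed
  have "(\<lambda>n. box_bump a b (real (Suc n)) x) \<longlonglongrightarrow> (\<Prod>i\<in>(Basis::'a set). 1 * 1)"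
    unfolding box_bump_def
  proof (intro tendsto_prod tendsto_mult)
    fix i :: 'a assume "i \<in> Basis"
    then have "x \<bullet> i - a \<bullet> i > 0" "b \<bullet> i - x \<bullet> i > 0" using True by (auto simp: mem_box)
    from lim[OF this(1)] lim[OF this(2)]
    show "(\<lambda>n. flat 0 (real (Suc n) * (x \<bullet> i) + - real (Suc n) * (a \<bullet> i))) \<longlonglongrightarrow> 1"
      "(\<lambda>n. flat 0 (- real (Suc n) * (x \<bullet> i) + real (Suc n) * (b \<bullet> i))) \<longlonglongrightarrow> 1"
      by (simp_all add: right_diff_distrib del: of_nat_Suc)
  qed
  then show ?thesis using True by simp
next
  case False
  then have "box_bump a b (real (Suc n)) x = 0" for n
    using box_bump_nonzero_iff[of "real (Suc n)" a b x] by auto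
  then show ?thesis using False by simp
qed

lemma test_functionI:
  assumes "\<And>k. Ck k f" and "{x. f x \<noteq> 0} \<subseteq> K" "compact K" "K \<subseteq> \<Omega>"
  shows "test_function \<Omega> f"
proof -
  have "closure {x. f x \<noteq> 0} \<subseteq> K"
    using assms by (intro closure_minimal compact_imp_closed)
  moreover from this have "compact (closure {x. f x \<noteq> 0})"
    using assms(3) bounded_subset by (auto simp: compact_eq_bounded_closed)
  ultimately show ?thesis
    using assms unfolding test_function_def by auto
qed

lemma test_function_box_bump:
  "n > 0 \<Longrightarrow> cbox a b \<subseteq> \<Omega> \<Longrightarrow> test_function \<Omega> (box_bump a b n)"
  by (rule test_functionI[OF Ck_box_bump, where K = "cbox a b"])
     (auto simp: box_bump_nonzero_iff box_subset_cbox[THEN subsetD])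

subsection \<open>Weak gradients of test functions\<close>

lemma test_function_Ck: "test_function \<Omega> f \<Longrightarrow> Ck k f"
  by (simp add: test_function_def)

lemma test_function_has_derivative:
  "test_function \<Omega> f \<Longrightarrow> (f has_derivative frechet_derivative f (at x)) (at x)"
  using Ck_Suc_has_derivative[OF test_function_Ck] .

lemma test_function_Ck_derivative:
  "test_function \<Omega> f \<Longrightarrow> i \<in> Basis \<Longrightarrow> Ck k (\<lambda>x. frechet_derivative f (at x) i)"
  using test_function_Ck[of \<Omega> f "Suc k"] by simp

lemma test_function_continuous: "test_function \<Omega> f \<Longrightarrow> continuous_on A f"
  using Ck_continuous[OF test_function_Ck] .

lemma test_function_continuous_derivative:
  "test_function \<Omega> f \<Longrightarrow> i \<in> Basis \<Longrightarrow>
    continuous_on A (\<lambda>x. frechet_derivative f (at x) i)"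
  using Ck_continuous[OF test_function_Ck_derivative] .

text \<open>The complement of the closed support is open and f is zero on it, so the derivative
  vanishes there as well. One compact set thus serves for f and its derivatives.\<close>

lemma test_function_supportE:
  assumes "test_function \<Omega> f"
  obtains K where "compact K" "K \<subseteq> \<Omega>" "\<And>x. x \<notin> K \<Longrightarrow> f x = 0"
    "\<And>x i. x \<notin> K \<Longrightarrow> frechet_derivative f (at x) i = 0"
proof
  define K where "K = closure {x. f x \<noteq> 0}"
  show "compact K" "K \<subseteq> \<Omega>" using assms by (auto simp: test_function_def K_def)
  show 0: "f x = 0" if "x \<notin> K" for x using that unfolding K_def using closure_subset[of "{x. f x \<noteq> 0}"] by auto
  show "frechet_derivative f (at x) i = 0" if x: "x \<notin> K" for x i
  proof -
    have "((\<lambda>_. 0) has_derivative (\<lambda>_. 0)) (at x)" by simp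
    then have "(f has_derivative (\<lambda>_. 0)) (at x)"
      by (rule has_derivative_transform_within_open[where s = "- K"]) (use x 0 \<open>compact K\<close> in \<open>auto intro: compact_imp_closed\<close>)
    from frechet_derivative_unique[OF this] show ?thesis by simp
  qed
qed

lemma integrable_compact_support:
  fixes g :: "'a::euclidean_space \<Rightarrow> real"
  assumes "continuous_on UNIV g" "compact K" "\<And>x. x \<notin> K \<Longrightarrow> g x = 0"
  shows "integrable lborel g"
proof -
  have "integrable lborel (\<lambda>x. indicator K x *\<^sub>R g x)"
    using assms by (intro borel_integrable_compact) (auto intro: continuous_on_subset)
  also have "(\<lambda>x. indicator K x *\<^sub>R g x) = g"
    using assms(3) by (auto simp: fun_eq_iff indicator_def)
  finally show ?thesis .
qed

text \<open>Extension by zero connects the integrals over \<Omega> in the definitions with integrals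
  over the whole space, where the translation argument takes place.\<close>

lemma integral_lebesgue_on_eq_lborel:
  fixes g :: "'a::euclidean_space \<Rightarrow> real"
  assumes "open \<Omega>" "continuous_on UNIV g" "\<And>x. x \<notin> \<Omega> \<Longrightarrow> g x = 0"
  shows "integral\<^sup>L (lebesgue_on \<Omega>) g = integral\<^sup>L lborel g"
proof -
  have "integral\<^sup>L (lebesgue_on \<Omega>) g = (\<integral>x. indicator \<Omega> x *\<^sub>R g x \<partial>lebesgue)"
    using assms by (intro integral_restrict_space) auto
  also have "(\<lambda>x. indicator \<Omega> x *\<^sub>R g x) = g"
    using assms(3) by (auto simp: fun_eq_iff indicator_def)
  also have "integral\<^sup>L lebesgue g = integral\<^sup>L lborel g"
    using assms by (intro integral_completion) (auto intro: borel_measurable_continuous_onI)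
  finally show ?thesis .
qed

lemma integrable_lebesgue_on_compact_support:
  fixes g :: "'a::euclidean_space \<Rightarrow> real"
  assumes "open \<Omega>" "continuous_on UNIV g" "compact K" "K \<subseteq> \<Omega>" "\<And>x. x \<notin> K \<Longrightarrow> g x = 0"
  shows "integrable (lebesgue_on \<Omega>) g"
proof -
  have "(\<lambda>x. indicator \<Omega> x *\<^sub>R g x) = g"
    using assms(4,5) by (auto simp: fun_eq_iff indicator_def)
  moreover have "integrable lebesgue g"
    using integrable_compact_support[OF assms(2,3,5)] integrable_completion by blast
  ultimately show ?thesis
    using assms(1) by (subst integrable_restrict_space) auto
qed

section \<open>Integration by parts from translation invariance\<close>

lemma integral_lborel_translation:
  fixes f :: "'a::euclidean_space \<Rightarrow> real"
  assumes "f \<in> borel_measurable borel"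
  shows "(\<integral>x. f (c + x) \<partial>lborel) = integral\<^sup>L lborel f"
  using integral_distr[of "(+) c" lborel borel f] assms
  by (simp add: lborel_distr_plus)

text \<open>
  By translation invariance the difference quotients of \<open>f\<close> in direction \<open>i\<close> have integral zero;
  dominated convergence passes to the limit without any appeal to Fubini's theorem.
\<close>

lemma integral_directional_derivative_eq_0:
  fixes f :: "'a::euclidean_space \<Rightarrow> real"
  assumes f: "test_function UNIV f" and i: "i \<in> Basis"
  shows "(\<integral>x. frechet_derivative f (at x) i \<partial>lborel) = 0"
proof -
  let ?d = "\<lambda>x. frechet_derivative f (at x) i"
  obtain K where K: "compact K" "\<And>x. x \<notin> K \<Longrightarrow> f x = 0" "\<And>x. x \<notin> K \<Longrightarrow> ?d x = 0"
    using test_function_supportE[OF f] by metis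
  have cont: "continuous_on UNIV f" "continuous_on UNIV ?d"
    using f i by (auto intro: test_function_continuous test_function_continuous_derivative)
  have "compact (?d ` K)"
    by (rule compact_continuous_image[OF continuous_on_subset[OF cont(2)] K(1)]) simp
  from compact_imp_bounded[OF this]
  obtain M where M0: "M > 0" and "\<And>x. x \<in> K \<Longrightarrow> \<bar>?d x\<bar> \<le> M"
    by (auto simp: bounded_pos)
  then have M: "\<bar>?d x\<bar> \<le> M" for x using K(3)[of x] by (cases "x \<in> K") auto
  define h where "h = (\<lambda>n. inverse (real (Suc n)))"
  have h: "0 < h n" "h n \<le> 1" for n
    by (auto simp: h_def field_simps)
  \<comment> \<open>This is K enlarged by the closed unit ball. The steps \<open>h n\<close> are at
    most 1, so all difference quotients vanish outside this one compact set.\<close>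
  define K' where "K' = (\<lambda>(x, y). x + y) ` (K \<times> cball 0 (1::real) :: ('a \<times> 'a) set)"
  have "compact K'" unfolding K'_def
    by (intro compact_continuous_image compact_Times K(1) compact_cball)
       (auto intro!: continuous_intros simp: case_prod_beta)
  have K'I: "x \<in> K'" if "x + t *\<^sub>R i \<in> K" "\<bar>t\<bar> \<le> 1" for x t
    unfolding K'_def using that i
    by (intro image_eqI[where x = "(x + t *\<^sub>R i, - t *\<^sub>R i)"]) auto
  define q where "q n x = (f (h n *\<^sub>R i + x) - f x) / h n" for n x
  have line: "((\<lambda>t. f (x + t *\<^sub>R i)) has_real_derivative ?d (x + t *\<^sub>R i)) (at t)" for x t
  proof -
    have "((\<lambda>t. f (x + t *\<^sub>R i)) has_derivative
        (\<lambda>s. frechet_derivative f (at (x + t *\<^sub>R i)) (s *\<^sub>R i))) (at t)"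
      by (rule has_derivative_compose[OF _ test_function_has_derivative[OF f]])
         (auto intro!: derivative_eq_intros)
    moreover have "frechet_derivative f (at (x + t *\<^sub>R i)) (s *\<^sub>R i) = ?d (x + t *\<^sub>R i) * s" for s
      using linear_frechet_derivative[OF Ck_Suc_differentiable[OF test_function_Ck[OF f]]]
      by (simp add: linear_cmul)
    ultimately show ?thesis by (simp add: has_field_derivative_def)
  qed
  \<comment> \<open>On K' the mean value theorem turns the quotient into a value of the derivative,
    which M bounds. Off K' both values of f are zero. The dominating function is therefore the same
    for all n.\<close>
  have bound: "\<bar>q n x\<bar> \<le> M * indicator K' x" for n x
  proof (cases "x \<in> K'")
    case True
    obtain t where t: "f (x + h n *\<^sub>R i) - f (x + 0 *\<^sub>R i) = (h n - 0) * ?d (x + t *\<^sub>R i)"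
      using MVT2[OF h(1)[of n], of "\<lambda>t. f (x + t *\<^sub>R i)" "\<lambda>t. ?d (x + t *\<^sub>R i)"] line by blast
    then have "q n x = ?d (x + t *\<^sub>R i)"
      using h(1)[of n] by (simp add: q_def add.commute)
    then show ?thesis using M True by simp
  next
    case False
    have "f (x + t *\<^sub>R i) = 0" if "\<bar>t\<bar> \<le> 1" for t
      using K(2) K'I[OF _ that] False by blast
    from this[of "h n"] this[of 0] show ?thesis using h[of n] M0 by (simp add: q_def add.commute)
  qed
  have lim: "(\<lambda>n. q n x) \<longlonglongrightarrow> ?d x" for x
  proof -
    have "((\<lambda>t. (f (x + t *\<^sub>R i) - f x) / t) \<longlongrightarrow> ?d x) (at 0)"
      using line[of x 0] by (simp add: DERIV_def)
    moreover have "filterlim h (at 0) sequentially"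
      using LIMSEQ_inverse_real_of_nat by (auto simp: filterlim_at h_def)
    ultimately have "(\<lambda>n. (f (x + h n *\<^sub>R i) - f x) / h n) \<longlonglongrightarrow> ?d x"
      by (rule filterlim_compose[where g = "\<lambda>t. (f (x + t *\<^sub>R i) - f x) / t"])
    then show ?thesis
      by (simp add: q_def add.commute)
  qed
  have fb: "f \<in> borel_measurable borel" 
    using cont by (intro borel_measurable_continuous_onI)
  have fi: "integrable lborel f"
    by (rule integrable_compact_support[OF cont(1) K(1,2)])
  have fti: "integrable lborel (\<lambda>x. f (c + x))" for c
    using integrable_distr_eq[of "(+) c" lborel borel f] fi fb by (simp add: lborel_distr_plus)
  have "integral\<^sup>L lborel (q n) = 0" for n
    unfolding q_def using fi fti by (simp add: integral_lborel_translation[OF fb])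
  moreover have "(\<lambda>n. integral\<^sup>L lborel (q n)) \<longlonglongrightarrow> integral\<^sup>L lborel ?d"
  proof (rule integral_dominated_convergence[where w = "\<lambda>x. M * indicator K' x"])
    show "integrable lborel (\<lambda>x. M * indicator K' x)"
      using borel_integrable_compact[OF \<open>compact K'\<close>, of "\<lambda>_. M"] by (simp add: mult.commute)
    show "?d \<in> borel_measurable lborel"
      using cont by (auto intro: borel_measurable_continuous_onI)
    show "q n \<in> borel_measurable lborel" for n
      unfolding q_def using fb by measurable
  qed (use lim bound in auto)
  ultimately show ?thesis
    using LIMSEQ_unique[OF _ tendsto_const[of "0::real"]] by simp
qed

lemma test_function_mult:
  assumes "test_function \<Omega> f" "\<And>k. Ck k g"
  shows "test_function \<Omega> (\<lambda>x. f x * g x)"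
proof -
  obtain K where "compact K" "K \<subseteq> \<Omega>" "\<And>x. x \<notin> K \<Longrightarrow> f x = 0"
    using test_function_supportE[OF assms(1)] by metis
  then show ?thesis
    by (intro test_functionI[where K = K])
       (auto intro: Ck_mult assms test_function_Ck)
qed

lemma test_function_mono: "test_function \<Omega> f \<Longrightarrow> \<Omega> \<subseteq> \<Omega>' \<Longrightarrow> test_function \<Omega>' f"
  by (auto simp: test_function_def)

text \<open>The classical gradient, in contrast to \<open>weak_gradient\<close>, which is picked by
  choice. For test functions the two turn out to agree almost everywhere.\<close>

definition gradient :: "('a::euclidean_space \<Rightarrow> real) \<Rightarrow> 'a \<Rightarrow> 'a" where
  "gradient f x = (\<Sum>i\<in>Basis. frechet_derivative f (at x) i *\<^sub>R i)"

lemma gradient_inner: "i \<in> Basis \<Longrightarrow> gradient f x \<bullet> i = frechet_derivative f (at x) i"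
  by (simp add: gradient_def)

lemma continuous_on_gradient: "test_function \<Omega> f \<Longrightarrow> continuous_on A (gradient f)"
  unfolding gradient_def[abs_def]
  by (intro continuous_on_sum continuous_on_scaleR continuous_on_const
      test_function_continuous_derivative)

lemma continuous_imp_locally_integrable:
  fixes f :: "'a::euclidean_space \<Rightarrow> 'b::euclidean_space"
  assumes "continuous_on UNIV f"
  shows "locally_integrable \<Omega> f"
  unfolding locally_integrable_def set_integrable_def
proof safe
  fix K :: "'a set" assume K: "compact K"
  have "integrable lborel (\<lambda>x. indicator K x *\<^sub>R f x)"
    using assms K by (intro borel_integrable_compact) (auto intro: continuous_on_subset)
  then show "integrable lebesgue (\<lambda>x. indicator K x *\<^sub>R f x)"
    by (subst integrable_completion) (auto dest: borel_measurable_integrable)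
qed

text \<open>Integration by parts: the product of w and \<phi> has compact support, so its
  directional derivative integrates to zero over the whole space, and the product rule splits this
  integral into the two required terms.\<close>

lemma test_function_has_weak_gradient:
  assumes \<Omega>: "open \<Omega>" and w: "test_function \<Omega> w"
  shows "has_weak_gradient \<Omega> w (gradient w)"
  unfolding has_weak_gradient_def
proof (intro conjI allI impI ballI)
  show "locally_integrable \<Omega> w" "locally_integrable \<Omega> (gradient w)"
    using w by (auto intro: continuous_imp_locally_integrable test_function_continuous
      continuous_on_gradient)
  fix \<phi> and i :: 'a assume \<phi>: "test_function \<Omega> \<phi>" and i: "i \<in> Basis"
  let ?d = "\<lambda>f x. frechet_derivative f (at x) i"
  obtain K where K: "compact K" "K \<subseteq> \<Omega>" "\<And>x. x \<notin> K \<Longrightarrow> w x = 0" "\<And>x. x \<notin> K \<Longrightarrow> ?d w x = 0"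
    using test_function_supportE[OF w] by metis
  have cont: "continuous_on UNIV (\<lambda>x. w x * ?d \<phi> x)" "continuous_on UNIV (\<lambda>x. ?d w x * \<phi> x)"
    using w \<phi> i
    by (auto intro!: continuous_on_mult intro: test_function_continuous test_function_continuous_derivative)
  have "test_function UNIV (\<lambda>x. w x * \<phi> x)"
    by (rule test_function_mult[OF test_function_mono[OF w] test_function_Ck[OF \<phi>]]) simp
  from integral_directional_derivative_eq_0[OF this i]
  have "0 = (\<integral>x. w x * ?d \<phi> x + ?d w x * \<phi> x \<partial>lborel)"
    using frechet_derivative_unique[OF has_derivative_mult[OF
        test_function_has_derivative[OF w] test_function_has_derivative[OF \<phi>]]]
    by simp
  also have "\<dots> = (\<integral>x. w x * ?d \<phi> x \<partial>lborel) + (\<integral>x. ?d w x * \<phi> x \<partial>lborel)"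
    using K by (intro Bochner_Integration.integral_add integrable_compact_support[OF _ K(1)] cont) auto
  also have "\<dots> = (\<integral>x. w x * ?d \<phi> x \<partial>lebesgue_on \<Omega>) + (\<integral>x. ?d w x * \<phi> x \<partial>lebesgue_on \<Omega>)"
  proof -
    have "w x = 0" "?d w x = 0" if "x \<notin> \<Omega>" for x using K that by auto
    then show ?thesis
      using cont by (simp add: integral_lebesgue_on_eq_lborel[OF \<Omega>])
  qed
  finally show "(\<integral>x. w x * ?d \<phi> x \<partial>lebesgue_on \<Omega>) = - (\<integral>x. (gradient w x \<bullet> i) * \<phi> x \<partial>lebesgue_on \<Omega>)"
    using i by (simp add: gradient_inner)
qed

subsection \<open>Uniqueness of weak gradients\<close>

text \<open>The test function is bounded and confines the product to a compact set on which H is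
  integrable, so a multiple of the absolute value of H on that set dominates.\<close>

lemma locally_integrable_mult_test_function:
  fixes H :: "'a::euclidean_space \<Rightarrow> real"
  assumes "open \<Omega>" "locally_integrable \<Omega> H" "test_function \<Omega> \<phi>"
  shows "integrable (lebesgue_on \<Omega>) (\<lambda>x. H x * \<phi> x)"
proof -
  obtain K where K: "compact K" "K \<subseteq> \<Omega>" "\<And>x. x \<notin> K \<Longrightarrow> \<phi> x = 0"
    using test_function_supportE[OF assms(3)] by metis
  have HK: "integrable lebesgue (\<lambda>x. indicator K x *\<^sub>R H x)"
    using assms(2) K unfolding locally_integrable_def set_integrable_def by auto
  have "compact (\<phi> ` K)"
    using test_function_continuous[OF assms(3)] K(1) by (rule compact_continuous_image)
  from compact_imp_bounded[OF this] obtain M where M: "\<And>x. x \<in> K \<Longrightarrow> \<bar>\<phi> x\<bar> \<le> M"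
    by (auto simp: bounded_iff)
  have "integrable lebesgue (\<lambda>x. (indicator K x *\<^sub>R H x) * \<phi> x)"
  proof (rule Bochner_Integration.integrable_bound)
    show "integrable lebesgue (\<lambda>x. M * \<bar>indicator K x *\<^sub>R H x\<bar>)"
      using HK by auto
    have "\<phi> \<in> borel_measurable lebesgue"
      using test_function_continuous[OF assms(3)] borel_measurable_continuous_onI
      by (intro measurable_completion) auto
    then show "(\<lambda>x. (indicator K x *\<^sub>R H x) * \<phi> x) \<in> borel_measurable lebesgue"
      using HK by (intro borel_measurable_times) auto
    have "\<bar>H x\<bar> * \<bar>\<phi> x\<bar> \<le> \<bar>M\<bar> * \<bar>H x\<bar>" if "x \<in> K" for x
    proof -
      have "\<bar>\<phi> x\<bar> \<le> \<bar>M\<bar>" using M[OF that] by linarith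
      then show ?thesis
        using mult_right_mono[of "\<bar>\<phi> x\<bar>" "\<bar>M\<bar>" "\<bar>H x\<bar>"] by (simp add: mult.commute)
    qed
    then show "AE x in lebesgue. norm ((indicator K x *\<^sub>R H x) * \<phi> x)
        \<le> norm (M * \<bar>indicator K x *\<^sub>R H x\<bar>)"
      by (intro AE_I2) (auto simp: indicator_def abs_mult)
  qed
  also have "(\<lambda>x. (indicator K x *\<^sub>R H x) * \<phi> x) = (\<lambda>x. indicator \<Omega> x *\<^sub>R (H x * \<phi> x))"
    using K(2,3) by (auto simp: fun_eq_iff indicator_def)
  finally show ?thesis
    using assms(1) by (subst integrable_restrict_space) auto
qed

text \<open>
  Integrals over open boxes vanish by approximating indicators by bumps, integrals over Borel sets
  by Dynkin's lemma.
\<close>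

lemma AE_zero_on_cbox:
  fixes H :: "'a::euclidean_space \<Rightarrow> real"
  assumes \<Omega>: "open \<Omega>" and H: "locally_integrable \<Omega> H"
    and 0: "\<And>\<phi>. test_function \<Omega> \<phi> \<Longrightarrow> (\<integral>x. H x * \<phi> x \<partial>lebesgue_on \<Omega>) = 0"
    and ab: "cbox a b \<subseteq> \<Omega>"
  shows "AE x in lebesgue. x \<in> cbox a b \<longrightarrow> H x = 0"
proof -
  \<comment> \<open>Cutting H off makes it integrable on the whole space. The integral of F over any
    open box is an integral of H over a box inside \<open>box a b\<close>, because open boxes are
    closed under intersection. This supplies the base case for Dynkin's lemma.\<close>
  define F where "F = (\<lambda>x. indicator (box a b) x * H x)"
  have Hc: "integrable lebesgue (\<lambda>x. indicator (cbox a b) x * H x)"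
    using H ab unfolding locally_integrable_def set_integrable_def by auto
  have Fint: "integrable lebesgue F"
  proof -
    have "F = (\<lambda>x. indicator (box a b) x *\<^sub>R (indicator (cbox a b) x * H x))"
      using box_subset_cbox[of a b] by (auto simp: F_def indicator_def fun_eq_iff)
    then show ?thesis
      using integrable_mult_indicator[OF _ Hc, of "box a b"] by simp
  qed
  have box: "(\<integral>x. indicator (box c d) x * H x \<partial>lebesgue) = 0" if "box c d \<subseteq> box a b" for c d
  proof -
    let ?s = "\<lambda>n x. indicator (cbox a b) x * H x * box_bump c d (real (Suc n)) x"
    have bump0: "box_bump c d (real (Suc n)) x = 0" if "x \<notin> cbox a b" for n x
      using that \<open>box c d \<subseteq> box a b\<close> box_subset_cbox[of a b]
        box_bump_nonzero_iff[of "real (Suc n)" c d x] by auto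
    have "(\<lambda>n. integral\<^sup>L lebesgue (?s n)) \<longlonglongrightarrow> (\<integral>x. indicator (box c d) x * H x \<partial>lebesgue)"
    proof (rule integral_dominated_convergence[where w = "\<lambda>x. \<bar>indicator (cbox a b) x * H x\<bar>"])
      have meas: "box_bump c d (real (Suc n)) \<in> borel_measurable lebesgue" for n
        using Ck_continuous[OF Ck_box_bump, of UNIV c d "real (Suc n)"] borel_measurable_continuous_onI
        by (intro measurable_completion) auto
      then show "?s n \<in> borel_measurable lebesgue" for n
        using Hc by (intro borel_measurable_times[OF _ meas]) auto
      have "(\<lambda>x. indicator (box c d) x * H x) =
          (\<lambda>x. indicator (box c d) x * (indicator (cbox a b) x * H x))"
        using \<open>box c d \<subseteq> box a b\<close> box_subset_cbox[of a b]
        by (auto simp: fun_eq_iff indicator_def)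
      then show "(\<lambda>x. indicator (box c d) x * H x) \<in> borel_measurable lebesgue"
        using borel_measurable_times[OF borel_measurable_indicator borel_measurable_integrable[OF Hc],
          of "box c d"] by simp
      show "AE x in lebesgue. (\<lambda>n. ?s n x) \<longlonglongrightarrow> indicator (box c d) x * H x"
      proof (rule AE_I2)
        fix x :: 'a
        have "(\<lambda>n. ?s n x) \<longlonglongrightarrow> indicator (cbox a b) x * H x * indicator (box c d) x"
          by (intro tendsto_mult tendsto_const box_bump_tendsto)
        also have "indicator (cbox a b) x * H x * indicator (box c d) x = indicator (box c d) x * H x"
          using \<open>box c d \<subseteq> box a b\<close> box_subset_cbox[of a b] by (auto simp: indicator_def)
        finally show "(\<lambda>n. ?s n x) \<longlonglongrightarrow> indicator (box c d) x * H x" .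
      qed
      show "AE x in lebesgue. norm (?s n x) \<le> \<bar>indicator (cbox a b) x * H x\<bar>" for n
        using box_bump_bounds[of c d "real (Suc n)"]
        by (intro AE_I2) (auto simp: abs_mult mult_left_le)
    qed (use Hc in auto)
    moreover have "integral\<^sup>L lebesgue (?s n) = 0" for n
    proof -
      \<comment> \<open>The compact set is \<open>cbox a b\<close>, since \<open>cbox c d\<close>
        may leave \<Omega> when \<open>box c d\<close> is empty.\<close>
      have "test_function \<Omega> (box_bump c d (real (Suc n)))"
        using bump0 ab by (intro test_functionI[OF Ck_box_bump, where K = "cbox a b"]) auto
      from 0[OF this]
      have "(\<integral>x. indicator \<Omega> x *\<^sub>R (H x * box_bump c d (real (Suc n)) x) \<partial>lebesgue) = 0"
        using \<Omega> by (subst (asm) integral_restrict_space) auto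
      also have "(\<lambda>x. indicator \<Omega> x *\<^sub>R (H x * box_bump c d (real (Suc n)) x)) = ?s n"
        using ab bump0[of _ n] by (auto simp: fun_eq_iff indicator_def)
      finally show ?thesis .
    qed
    ultimately show ?thesis
      using LIMSEQ_unique[OF _ tendsto_const[of "0::real"]] by simp
  qed
  have borel: "set_lebesgue_integral lebesgue A F = 0" if "A \<in> sets borel" for A
  proof -
    have sets_eq: "sigma_sets UNIV (range (\<lambda>(a, b). box a b :: 'a set)) = sets borel"
      by (subst borel_eq_box) simp
    have "Int_stable (range (\<lambda>(a, b). box a b :: 'a set))"
      by (auto simp: Int_stable_def box_Int_box)
    moreover have "range (\<lambda>(a, b). box a b :: 'a set) \<subseteq> Pow UNIV" by simp
    moreover have "A \<in> sigma_sets UNIV (range (\<lambda>(a, b). box a b))"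
      using that by (simp add: sets_eq)
    ultimately show ?thesis
    proof (induction rule: sigma_sets_induct_disjoint)
      case (basic A)
      then obtain c d where "A = box c d" by auto
      moreover obtain c' d' where cd: "box c d \<inter> box a b = box c' d'"
        using box_Int_box[of c d a b] by blast
      ultimately have "(\<lambda>x. indicator A x *\<^sub>R F x) = (\<lambda>x. indicator (box c' d') x * H x)"
        by (auto simp: F_def fun_eq_iff indicator_def)
      then show ?case
        using box[of c' d'] cd[symmetric] by (simp add: set_lebesgue_integral_def)
    next
      case (compl A)
      then have A: "A \<in> sets lebesgue" unfolding sets_eq by simp
      have "integral\<^sup>L lebesgue F = 0"
        using box[of a b] by (simp add: F_def)
      moreover have "(\<lambda>x. indicator (UNIV - A) x *\<^sub>R F x) = (\<lambda>x. F x - indicator A x *\<^sub>R F x)"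
        by (auto simp: fun_eq_iff indicator_def)
      ultimately show ?case
        using compl(2) Fint integrable_mult_indicator[OF A Fint] by (simp add: set_lebesgue_integral_def)
    next
      case (union A)
      then have A: "A i \<in> sets lebesgue" for i unfolding sets_eq by auto
      then have "set_integrable lebesgue (\<Union>i. A i) F"
        using integrable_mult_indicator[OF _ Fint, of "\<Union>i. A i"] by (auto simp: set_integrable_def)
      then have "(LINT x:(\<Union>i. A i)|lebesgue. F x) = (\<Sum>i. (LINT x:(A i)|lebesgue. F x))"
        using union A by (intro lebesgue_integral_countable_add) (auto simp: disjoint_family_on_def)
      then show ?case using union by simp
    qed (simp add: set_lebesgue_integral_def)
  qed
  \<comment> \<open>The criterion for a vanishing density is applied to the sigma-finite measure
    \<open>lborel\<close>, so F is first replaced by a Borel function equal to it almost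
    everywhere.\<close>
  obtain F' where F': "F' \<in> borel_measurable lborel" "AE x in lborel. F x = F' x"
    using completion_ex_borel_measurable_real[OF borel_measurable_integrable[OF Fint]] by auto
  have ae: "AE x in lebesgue. F x = F' x" using F'(2) by (rule AE_completion)
  have "AE x in lborel. F' x = 0"
  proof (rule sigma_finite_measure.density_zero[OF sigma_finite_lborel])
    have "integrable lebesgue F'"
      using integrable_cong_AE[OF borel_measurable_integrable[OF Fint] measurable_completion[OF F'(1)] ae]
        Fint by blast
    then show "integrable lborel F'" using F'(1) by (simp add: integrable_completion)
    fix A :: "'a set" assume A: "A \<in> sets lborel"
    have "set_lebesgue_integral lborel A F' = set_lebesgue_integral lebesgue A F'"
      unfolding set_lebesgue_integral_def using F'(1) A
      by (intro integral_completion[symmetric]) auto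
    also have "\<dots> = set_lebesgue_integral lebesgue A F"
      unfolding set_lebesgue_integral_def
    proof (rule integral_cong_AE)
      have A': "A \<in> sets lebesgue" using A by simp
      show "(\<lambda>x. indicator A x *\<^sub>R F' x) \<in> borel_measurable lebesgue"
        using borel_measurable_indicator[OF A'] measurable_completion[OF F'(1)]
        by (rule borel_measurable_scaleR)
      show "(\<lambda>x. indicator A x *\<^sub>R F x) \<in> borel_measurable lebesgue"
        using borel_measurable_indicator[OF A'] borel_measurable_integrable[OF Fint]
        by (rule borel_measurable_scaleR)
      show "AE x in lebesgue. indicator A x *\<^sub>R F' x = indicator A x *\<^sub>R F x"
        using ae by eventually_elim simp
    qed
    finally show "set_lebesgue_integral lborel A F' = 0" using borel A by simp
  qed
  then have "AE x in lebesgue. F' x = 0" by (rule AE_completion)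
  \<comment> \<open>F carries information on the open box only; the faces of the closed box form a
    null set.\<close>
  moreover have "AE x in lebesgue. x \<notin> cbox a b - box a b"
    using negligible_frontier_interval[of a b] by (intro AE_not_in) (simp add: negligible_iff_null_sets)
  ultimately show ?thesis
    using ae by eventually_elim (auto simp: F_def indicator_def split: if_splits)
qed

text \<open>The fundamental lemma of the calculus of variations. An open set is a countable union of
  closed boxes, so the exceptional null sets of the boxes combine into one.\<close>

lemma AE_zero_if_orthogonal_to_test_functions:
  fixes H :: "'a::euclidean_space \<Rightarrow> real"
  assumes "open \<Omega>" "locally_integrable \<Omega> H"
    and "\<And>\<phi>. test_function \<Omega> \<phi> \<Longrightarrow> (\<integral>x. H x * \<phi> x \<partial>lebesgue_on \<Omega>) = 0"
  shows "AE x in lebesgue_on \<Omega>. H x = 0"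
proof -
  obtain \<D> where D: "countable \<D>" "\<D> \<subseteq> Pow \<Omega>" "\<And>X. X \<in> \<D> \<Longrightarrow> \<exists>a b. X = cbox a b" "\<Union>\<D> = \<Omega>"
    using open_countable_Union_open_cbox[OF assms(1)] by metis
  have "AE x in lebesgue. \<forall>X\<in>\<D>. x \<in> X \<longrightarrow> H x = 0"
  proof (rule AE_ball_countable'[OF _ D(1)])
    fix X assume X: "X \<in> \<D>"
    obtain a b where "X = cbox a b" using D(3)[OF X] by blast
    then show "AE x in lebesgue. x \<in> X \<longrightarrow> H x = 0"
      using AE_zero_on_cbox[OF assms, of a b] X D(2) by auto
  qed
  then have "AE x in lebesgue. x \<in> \<Omega> \<longrightarrow> H x = 0"
    by eventually_elim (use D(4) in auto)
  then show ?thesis using assms(1) by (simp add: AE_restrict_space_iff)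
qed

text \<open>The fundamental lemma is applied to each coordinate of the difference. The result allows
  the norm of the chosen \<open>weak_gradient\<close> to be computed from any other weak
  gradient.\<close>

lemma weak_gradient_unique:
  assumes \<Omega>: "open \<Omega>" and G: "has_weak_gradient \<Omega> w G" "has_weak_gradient \<Omega> w G'"
  shows "AE x in lebesgue_on \<Omega>. G x = G' x"
proof -
  have "AE x in lebesgue_on \<Omega>. G x \<bullet> i - G' x \<bullet> i = 0" if i: "i \<in> Basis" for i
  proof (rule AE_zero_if_orthogonal_to_test_functions[OF \<Omega>])
    have loc: "locally_integrable \<Omega> (\<lambda>x. G x \<bullet> i)" if "locally_integrable \<Omega> G" for G :: "'a \<Rightarrow> 'a"
      unfolding locally_integrable_def set_integrable_def
    proof safe
      fix K assume "compact K" "K \<subseteq> \<Omega>"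
      then have "integrable lebesgue (\<lambda>x. indicator K x *\<^sub>R G x)"
        using that by (auto simp: locally_integrable_def set_integrable_def)
      from integrable_inner_left[OF this, of i]
      show "integrable lebesgue (\<lambda>x. indicator K x *\<^sub>R (G x \<bullet> i))" by simp
    qed
    from G have L: "locally_integrable \<Omega> (\<lambda>x. G x \<bullet> i)" "locally_integrable \<Omega> (\<lambda>x. G' x \<bullet> i)"
      by (auto simp: has_weak_gradient_def intro!: loc)
    then show "locally_integrable \<Omega> (\<lambda>x. G x \<bullet> i - G' x \<bullet> i)"
      unfolding locally_integrable_def by (auto intro: set_integral_diff)
    fix \<phi> assume \<phi>: "test_function \<Omega> \<phi>"
    have "(\<integral>x. (G x \<bullet> i) * \<phi> x \<partial>lebesgue_on \<Omega>) = (\<integral>x. (G' x \<bullet> i) * \<phi> x \<partial>lebesgue_on \<Omega>)"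
      using G[unfolded has_weak_gradient_def, THEN conjunct2, THEN conjunct2, rule_format, OF \<phi> i]
      by simp
    then show "(\<integral>x. (G x \<bullet> i - G' x \<bullet> i) * \<phi> x \<partial>lebesgue_on \<Omega>) = 0"
      using L[THEN locally_integrable_mult_test_function[OF \<Omega> _ \<phi>]]
      by (simp add: left_diff_distrib)
  qed
  then have "AE x in lebesgue_on \<Omega>. \<forall>i\<in>Basis. G x \<bullet> i - G' x \<bullet> i = 0"
    by (intro AE_finite_allI) auto
  then show ?thesis
    by eventually_elim (auto intro: euclidean_eqI)
qed

subsection \<open>The energy of test functions\<close>

lemma Lp_norm_powr: "q > 0 \<Longrightarrow> Lp_norm q M f powr q = (\<integral>x. norm (f x) powr q \<partial>M)"
  by (simp add: Lp_norm_def powr_powr)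

lemma Lp_norm_2_squared: "(Lp_norm 2 M f)\<^sup>2 = (\<integral>x. (norm (f x))\<^sup>2 \<partial>M)"
  using Lp_norm_powr[of 2 M f] by (simp add: Lp_norm_def)

lemma grad_norm_test_function:
  assumes \<Omega>: "open \<Omega>" and w: "test_function \<Omega> w"
  shows "(grad_norm \<Omega> w)\<^sup>2 = (\<integral>x. (norm (gradient w x))\<^sup>2 \<partial>lebesgue_on \<Omega>)"
proof -
  have G: "has_weak_gradient \<Omega> w (weak_gradient \<Omega> w)"
    unfolding weak_gradient_def
    using someI[of "has_weak_gradient \<Omega> w", OF test_function_has_weak_gradient[OF assms]] .
  have ae: "AE x in lebesgue_on \<Omega>. weak_gradient \<Omega> w x = gradient w x"
    by (rule weak_gradient_unique[OF \<Omega> G test_function_has_weak_gradient[OF assms]])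
  have m: "gradient w \<in> borel_measurable (lebesgue_on \<Omega>)"
    using continuous_on_gradient[OF w] \<Omega> by (intro continuous_imp_measurable_on_sets_lebesgue) auto
  \<comment> \<open>The chosen representative agrees almost everywhere with a continuous function,
    and measurability transfers because Lebesgue measure is complete.\<close>
  have m': "weak_gradient \<Omega> w \<in> borel_measurable (lebesgue_on \<Omega>)"
  proof -
    have "(\<lambda>x. indicator \<Omega> x *\<^sub>R gradient w x) \<in> borel_measurable lebesgue"
      using m \<Omega> by (subst (asm) borel_measurable_restrict_space_iff) auto
    moreover have "AE x in lebesgue. indicator \<Omega> x *\<^sub>R gradient w x = indicator \<Omega> x *\<^sub>R weak_gradient \<Omega> w x"
      using ae \<Omega> by (simp add: AE_restrict_space_iff) (auto elim!: eventually_mono simp: indicator_def)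
    ultimately have "(\<lambda>x. indicator \<Omega> x *\<^sub>R weak_gradient \<Omega> w x) \<in> borel_measurable lebesgue"
      by (rule borel_measurable_AE)
    then show ?thesis
      using \<Omega> by (subst borel_measurable_restrict_space_iff) auto
  qed
  have "(\<integral>x. (norm (weak_gradient \<Omega> w x))\<^sup>2 \<partial>lebesgue_on \<Omega>)
      = (\<integral>x. (norm (gradient w x))\<^sup>2 \<partial>lebesgue_on \<Omega>)"
  proof (rule integral_cong_AE)
    show "(\<lambda>x. (norm (gradient w x))\<^sup>2) \<in> borel_measurable (lebesgue_on \<Omega>)"
      using m by simp
    show "(\<lambda>x. (norm (weak_gradient \<Omega> w x))\<^sup>2) \<in> borel_measurable (lebesgue_on \<Omega>)"
      using m' by simp
    show "AE x in lebesgue_on \<Omega>. (norm (weak_gradient \<Omega> w x))\<^sup>2 = (norm (gradient w x))\<^sup>2"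
      using ae by eventually_elim simp
  qed
  then show ?thesis by (simp add: grad_norm_def Lp_norm_2_squared)
qed

lemma test_function_powr_integrable:
  assumes \<Omega>: "open \<Omega>" and w: "test_function \<Omega> w" and q: "q > 0"
  shows "integrable (lebesgue_on \<Omega>) (\<lambda>x. \<bar>w x\<bar> powr q)"
proof -
  obtain K where K: "compact K" "K \<subseteq> \<Omega>" "\<And>x. x \<notin> K \<Longrightarrow> w x = 0"
    using test_function_supportE[OF w] by metis
  show ?thesis
    using q K test_function_continuous[OF w]
    by (intro integrable_lebesgue_on_compact_support[OF \<Omega> _ K(1,2)] continuous_on_powr'
        continuous_on_const continuous_on_rabs) auto
qed

lemma test_function_square_integrable:
  assumes "open \<Omega>" "test_function \<Omega> w"
  shows "integrable (lebesgue_on \<Omega>) (\<lambda>x. (w x)\<^sup>2)"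
  using test_function_powr_integrable[OF assms, of 2] by simp

lemma test_function_gradient_square_integrable:
  assumes \<Omega>: "open \<Omega>" and w: "test_function \<Omega> w"
  shows "integrable (lebesgue_on \<Omega>) (\<lambda>x. (norm (gradient w x))\<^sup>2)"
proof -
  obtain K where K: "compact K" "K \<subseteq> \<Omega>" "\<And>x i. x \<notin> K \<Longrightarrow> frechet_derivative w (at x) i = 0"
    using test_function_supportE[OF w] by metis
  show ?thesis
    using K continuous_on_gradient[OF w]
    by (intro integrable_lebesgue_on_compact_support[OF \<Omega> _ K(1,2)] continuous_on_power
        continuous_on_norm) (auto simp: gradient_def)
qed

lemma test_function_derivative:
  assumes w: "test_function \<Omega> w" and i: "i \<in> Basis"
  shows "test_function \<Omega> (\<lambda>x. frechet_derivative w (at x) i)"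
proof -
  obtain K where "compact K" "K \<subseteq> \<Omega>" "\<And>x i. x \<notin> K \<Longrightarrow> frechet_derivative w (at x) i = 0"
    using test_function_supportE[OF w] by metis
  then show ?thesis
    by (intro test_functionI[where K = K] test_function_Ck_derivative[OF assms]) auto
qed

lemma test_function_in_H1:
  assumes "open \<Omega>" "test_function \<Omega> w"
  shows "w \<in> H1 \<Omega>"
proof -
  have "w \<in> borel_measurable (lebesgue_on \<Omega>)" "gradient w \<in> borel_measurable (lebesgue_on \<Omega>)"
    using assms by (auto intro!: continuous_imp_measurable_on_sets_lebesgue
      test_function_continuous continuous_on_gradient)
  then show ?thesis
    using test_function_has_weak_gradient[OF assms] test_function_square_integrable[OF assms]
      test_function_gradient_square_integrable[OF assms]
    by (auto simp: H1_def Lp_space_def intro!: bexI[of _ "gradient w"])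
qed

section \<open>Zero traces of compactly supported functions\<close>

lemma space_surface_measure: "space (surface_measure \<Omega>) = frontier \<Omega>"
  by (simp add: surface_measure_def hausdorff_measure_def space_restrict_space space_measure_of_conv)

lemma test_function_zero: "test_function \<Omega> (\<lambda>_. 0)"
  by (auto simp: test_function_def Ck_const)

lemma gradient_zero: "gradient (\<lambda>_. 0) = (\<lambda>_. 0)"
  by (simp add: gradient_def fun_eq_iff)

text \<open>The function itself serves as a constant approximating sequence. It vanishes on the
  frontier, which is disjoint from the open set \<Omega>, so zero is a trace.\<close>

lemma test_function_in_H1_vanishing:
  assumes \<Omega>: "open \<Omega>" and w: "test_function \<Omega> w"
  shows "w \<in> H1_vanishing \<Omega> \<Gamma>\<^sub>0"
proof -
  have "has_trace \<Omega> w (\<lambda>_. 0)"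
    unfolding has_trace_def
  proof (intro conjI exI[of _ "\<lambda>_. w"] allI)
    show "w \<in> H1 \<Omega>" "w \<in> H1 \<Omega>" using test_function_in_H1[OF assms] by auto
    show "continuous_on (closure \<Omega>) w" using test_function_continuous[OF w] .
    show "(\<lambda>_. 0) \<in> Lp_space 2 (surface_measure \<Omega>)" by (simp add: Lp_space_def)
    \<comment> \<open>Even for the zero function \<open>weak_gradient\<close> is a choice, so its
      norm is obtained from the identification with the classical gradient.\<close>
    have "(grad_norm \<Omega> (\<lambda>_. 0))\<^sup>2 = 0"
      using grad_norm_test_function[OF \<Omega> test_function_zero] by (simp add: gradient_zero)
    then show "(\<lambda>k. H1_norm \<Omega> (\<lambda>x. w x - w x)) \<longlonglongrightarrow> 0"
      by (simp add: H1_norm_def Lp_norm_2_squared del: power_eq_0_iff)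
    have "w x = 0" if "x \<in> frontier \<Omega>" for x
      using that \<Omega> test_function_supportE[OF w] by (metis frontier_disjoint_eq disjoint_iff subsetD)
    then have "Lp_norm 2 (surface_measure \<Omega>) (\<lambda>x. w x - 0) = Lp_norm 2 (surface_measure \<Omega>) (\<lambda>x. 0::real)"
      unfolding Lp_norm_def
      by (intro arg_cong[where f = "\<lambda>t. t powr (1 / 2)"] Bochner_Integration.integral_cong)
         (auto simp: space_surface_measure)
    then show "(\<lambda>k. Lp_norm 2 (surface_measure \<Omega>) (\<lambda>x. w x - 0)) \<longlonglongrightarrow> 0"
      by (simp add: Lp_norm_def)
  qed
  then show ?thesis
    using test_function_in_H1[OF assms] by (auto simp: H1_vanishing_def)
qed

text \<open>Homogeneity of degrees 2 and p reduces the functional on a ray to a function of one real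
  variable, in the form treated by \<open>fibering_level\<close>. The factor s stands on the right
  to match \<open>test_function_mult\<close>.\<close>

lemma J_scaled_test_function:
  assumes \<Omega>: "open \<Omega>" and w: "test_function \<Omega> w" and p: "p > 0" and s: "s \<ge> 0"
  shows "J \<Omega> p (\<lambda>x. w x * s) = s\<^sup>2 / 2 * (\<integral>x. (norm (gradient w x))\<^sup>2 \<partial>lebesgue_on \<Omega>)
    - s powr p / p * (\<integral>x. \<bar>w x\<bar> powr p \<partial>lebesgue_on \<Omega>)"
proof -
  have "gradient (\<lambda>x. w x * s) = (\<lambda>x. s *\<^sub>R gradient w x)"
    using frechet_derivative_unique[OF has_derivative_mult_left[OF test_function_has_derivative[OF w]]]
    by (simp add: gradient_def fun_eq_iff scaleR_sum_right mult.commute)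
  then have "(grad_norm \<Omega> (\<lambda>x. w x * s))\<^sup>2 = s\<^sup>2 * (\<integral>x. (norm (gradient w x))\<^sup>2 \<partial>lebesgue_on \<Omega>)"
    using grad_norm_test_function[OF \<Omega> test_function_mult[OF w Ck_const]]
    by (simp add: power_mult_distrib)
  moreover have "Lp_norm p (lebesgue_on \<Omega>) (\<lambda>x. w x * s) powr p
      = s powr p * (\<integral>x. \<bar>w x\<bar> powr p \<partial>lebesgue_on \<Omega>)"
    using p s by (simp add: Lp_norm_powr abs_mult powr_mult mult.commute)
  ultimately show ?thesis by (simp add: J_def)
qed

text \<open>By continuity the set where w is nonzero is open; it meets \<Omega> and hence is not
  negligible.\<close>

lemma test_function_integral_pos:
  assumes \<Omega>: "open \<Omega>" and w: "test_function \<Omega> w" and x: "w x \<noteq> 0" and q: "q > 0"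
  shows "(\<integral>x. \<bar>w x\<bar> powr q \<partial>lebesgue_on \<Omega>) > 0"
    and "\<not> (AE x in lebesgue_on \<Omega>. w x = 0)"
proof -
  have "x \<in> \<Omega>" using test_function_supportE[OF w] x by (metis subsetD)
  let ?U = "{y. w y \<noteq> 0} \<inter> \<Omega>"
  have "open {y. w y \<noteq> 0}"
    using test_function_continuous[OF w] by (intro open_Collect_neq) auto
  then have "\<not> negligible ?U"
    using \<Omega> x \<open>x \<in> \<Omega>\<close> by (intro open_not_negligible) auto
  show nae: "\<not> (AE x in lebesgue_on \<Omega>. w x = 0)"
  proof
    assume "AE x in lebesgue_on \<Omega>. w x = 0"
    then have "AE x in lebesgue. x \<notin> ?U"
      using \<Omega> by (simp add: AE_restrict_space_iff) (auto elim: eventually_mono)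
    then have "?U \<in> null_sets lebesgue"
      using \<open>open {y. w y \<noteq> 0}\<close> \<Omega> by (subst AE_iff_null_sets) auto
    with \<open>\<not> negligible ?U\<close> show False by (simp add: negligible_iff_null_sets)
  qed
  have "(\<integral>x. \<bar>w x\<bar> powr q \<partial>lebesgue_on \<Omega>) \<noteq> 0"
    using nae test_function_powr_integrable[OF \<Omega> w q]
    by (subst integral_nonneg_eq_0_iff_AE) auto
  moreover have "(\<integral>x. \<bar>w x\<bar> powr q \<partial>lebesgue_on \<Omega>) \<ge> 0" by (intro integral_nonneg_AE) auto
  ultimately show "(\<integral>x. \<bar>w x\<bar> powr q \<partial>lebesgue_on \<Omega>) > 0" by linarith
qed

text \<open>
  Take \<open>v = \<psi> (2 + sin (k x\<^bsub>e\<^esub> + \<theta>))\<close> with \<open>k\<close> large. The squared cosines for \<open>\<theta> = 0\<close> and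
  \<open>\<theta> = \<pi> / 2\<close> add up to \<open>1\<close>, so for one of these phases the leading term of the gradient
  carries at least half of the mass of \<open>\<psi>\<^sup>2\<close>; this replaces the Riemann-Lebesgue lemma.
\<close>

lemma oscillating_test_function:
  fixes \<psi> :: "'a::euclidean_space \<Rightarrow> real"
  assumes \<Omega>: "open \<Omega>" and \<psi>: "test_function \<Omega> \<psi>" and x0: "\<psi> x0 \<noteq> 0"
  shows "\<exists>v. test_function \<Omega> v \<and> (\<forall>x. \<bar>\<psi> x\<bar> \<le> \<bar>v x\<bar> \<and> \<bar>v x\<bar> \<le> 3 * \<bar>\<psi> x\<bar>) \<and>
    C \<le> (\<integral>x. (norm (gradient v x))\<^sup>2 \<partial>lebesgue_on \<Omega>)"
proof -
  obtain e :: 'a where e: "e \<in> Basis" using nonempty_Basis by blast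
  define P where "P = (\<integral>x. (\<psi> x)\<^sup>2 \<partial>lebesgue_on \<Omega>)"
  define Q where "Q = (\<integral>x. (frechet_derivative \<psi> (at x) e)\<^sup>2 \<partial>lebesgue_on \<Omega>)"
  have P: "P > 0"
    using test_function_integral_pos(1)[OF \<Omega> \<psi> x0, of 2] by (simp add: P_def)
  \<comment> \<open>The leading term will contribute at least k^2/2 times P/2. This k makes that
    product equal to |C| + 9|Q|, enough to absorb the error 9Q and still leave C.\<close>
  define k where "k = sqrt (4 / P * (\<bar>C\<bar> + 9 * \<bar>Q\<bar>))"
  have k: "k\<^sup>2 * P / 4 = \<bar>C\<bar> + 9 * \<bar>Q\<bar>"
    using P by (simp add: k_def)
  define v where "v j x = \<psi> x * (2 + sin (k * (x \<bullet> e) + real j * pi / 2))" for j x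
  define c where "c j x = cos (k * (x \<bullet> e) + real j * pi / 2)" for j x
  have Ck_s: "Ck n (\<lambda>x. 2 + sin (k * (x \<bullet> e) + real j * pi / 2))" for n j
    by (intro Ck_add Ck_const Ck_compose[where D = "\<lambda>j t. sin (t + real j * pi / 2)"]
        sin_derivatives Ck_mult Ck_inner)
  have v: "test_function \<Omega> (v j)" for j
    unfolding v_def by (intro test_function_mult[OF \<psi>] Ck_s)
  have v_bounds: "\<bar>\<psi> x\<bar> \<le> \<bar>v j x\<bar>" "\<bar>v j x\<bar> \<le> 3 * \<bar>\<psi> x\<bar>" for j x
  proof -
    let ?t = "2 + sin (k * (x \<bullet> e) + real j * pi / 2)"
    have "1 \<le> ?t" "?t \<le> 3"
      using sin_ge_minus_one[of "k * (x \<bullet> e) + real j * pi / 2"]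
        sin_le_one[of "k * (x \<bullet> e) + real j * pi / 2"] by linarith+
    then show "\<bar>\<psi> x\<bar> \<le> \<bar>v j x\<bar>" "\<bar>v j x\<bar> \<le> 3 * \<bar>\<psi> x\<bar>"
      using mult_left_mono[of 1 ?t "\<bar>\<psi> x\<bar>"] mult_left_mono[of ?t 3 "\<bar>\<psi> x\<bar>"]
      by (simp_all add: v_def abs_mult mult.commute)
  qed
  have ic: "integrable (lebesgue_on \<Omega>) (\<lambda>x. (\<psi> x * c j x)\<^sup>2)" for j
  proof -
    \<comment> \<open>The cosine is the sine with phase advanced by \<pi>/2, so its smoothness comes
      from the same indexed family.\<close>
    have "Ck n (\<lambda>x. sin ((k * (x \<bullet> e) + real j * pi / 2) + real 1 * pi / 2))" for n
      by (intro Ck_compose[where D = "\<lambda>j t. sin (t + real j * pi / 2)"]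
        sin_derivatives Ck_add Ck_const Ck_mult Ck_inner)
    then have "Ck n (c j)" for n
      unfolding c_def by (simp add: sin_add[of _ "pi / 2"])
    from test_function_square_integrable[OF \<Omega> test_function_mult[OF \<psi> this]]
    show ?thesis .
  qed
  have iQ: "integrable (lebesgue_on \<Omega>) (\<lambda>x. (frechet_derivative \<psi> (at x) e)\<^sup>2)"
    by (rule test_function_square_integrable[OF \<Omega> test_function_derivative[OF \<psi> e]])
  have lower: "k\<^sup>2 / 2 * (\<integral>x. (\<psi> x * c j x)\<^sup>2 \<partial>lebesgue_on \<Omega>) - 9 * Q
      \<le> (\<integral>x. (norm (gradient (v j) x))\<^sup>2 \<partial>lebesgue_on \<Omega>)" (is "?l \<le> _") for j
  proof -
    have "?l = (\<integral>x. k\<^sup>2 / 2 * (\<psi> x * c j x)\<^sup>2 - 9 * (frechet_derivative \<psi> (at x) e)\<^sup>2 \<partial>lebesgue_on \<Omega>)"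
      using ic iQ by (simp add: Q_def)
    also have "\<dots> \<le> (\<integral>x. (norm (gradient (v j) x))\<^sup>2 \<partial>lebesgue_on \<Omega>)"
    proof (rule integral_mono)
      show "integrable (lebesgue_on \<Omega>)
          (\<lambda>x. k\<^sup>2 / 2 * (\<psi> x * c j x)\<^sup>2 - 9 * (frechet_derivative \<psi> (at x) e)\<^sup>2)"
        using ic iQ by simp
      show "integrable (lebesgue_on \<Omega>) (\<lambda>x. (norm (gradient (v j) x))\<^sup>2)"
        by (rule test_function_gradient_square_integrable[OF \<Omega> v])
      fix x
      let ?t = "2 + sin (k * (x \<bullet> e) + real j * pi / 2)"
      let ?A = "k * (\<psi> x * c j x)" and ?B = "frechet_derivative \<psi> (at x) e * ?t"
      have d: "((\<lambda>x. 2 + sin (k * (x \<bullet> e) + real j * pi / 2)) has_derivative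
          (\<lambda>h. c j x * (k * (h \<bullet> e)))) (at x)"
        unfolding c_def by (auto intro!: derivative_eq_intros)
      \<comment> \<open>One component of the gradient suffices for a lower bound. In it,
        \<open>?A\<close> comes from the oscillating factor and grows with k, while
        \<open>?B\<close> comes from the derivative of \<psi> and is bounded independently of
        k.\<close>
      have "gradient (v j) x \<bullet> e = ?A + ?B"
        using frechet_derivative_unique[OF has_derivative_mult[OF test_function_has_derivative[OF \<psi>] d]] e
        by (simp add: gradient_inner v_def[abs_def])
      then have "\<bar>?A + ?B\<bar> \<le> norm (gradient (v j) x)"
        using Basis_le_norm[OF e, of "gradient (v j) x"] by simp
      then have "(?A + ?B)\<^sup>2 \<le> (norm (gradient (v j) x))\<^sup>2"
        using abs_le_square_iff[of "?A + ?B" "norm (gradient (v j) x)"] by simp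
      \<comment> \<open>The difference of the two sides is (A + 2B)^2 / 2.\<close>
      moreover have "?A\<^sup>2 / 2 - ?B\<^sup>2 \<le> (?A + ?B)\<^sup>2"
        using zero_le_power2[of "?A + 2 * ?B"] by (simp add: power2_eq_square algebra_simps)
      moreover have "?B\<^sup>2 \<le> 9 * (frechet_derivative \<psi> (at x) e)\<^sup>2"
      proof -
        have "\<bar>?t\<bar> \<le> \<bar>3\<bar>"
          using sin_ge_minus_one[of "k * (x \<bullet> e) + real j * pi / 2"]
            sin_le_one[of "k * (x \<bullet> e) + real j * pi / 2"] by linarith
        then have "?t\<^sup>2 \<le> 3\<^sup>2" by (rule abs_le_square_iff[THEN iffD1])
        then show ?thesis
          using mult_left_mono[of "?t\<^sup>2" 9 "(frechet_derivative \<psi> (at x) e)\<^sup>2"]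
          by (simp add: power_mult_distrib mult.commute)
      qed
      ultimately show "k\<^sup>2 / 2 * (\<psi> x * c j x)\<^sup>2 - 9 * (frechet_derivative \<psi> (at x) e)\<^sup>2
          \<le> (norm (gradient (v j) x))\<^sup>2"
        by (simp add: power_mult_distrib)
    qed
    finally show ?thesis .
  qed
  have "P = (\<integral>x. (\<psi> x * c 0 x)\<^sup>2 + (\<psi> x * c 1 x)\<^sup>2 \<partial>lebesgue_on \<Omega>)"
    unfolding P_def c_def
    by (simp add: cos_add[of _ "pi / 2"] power_mult_distrib distrib_left[symmetric])
  also have "\<dots> = (\<integral>x. (\<psi> x * c 0 x)\<^sup>2 \<partial>lebesgue_on \<Omega>) + (\<integral>x. (\<psi> x * c 1 x)\<^sup>2 \<partial>lebesgue_on \<Omega>)"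
    using ic by (intro Bochner_Integration.integral_add)
  finally have "P / 2 \<le> (\<integral>x. (\<psi> x * c 0 x)\<^sup>2 \<partial>lebesgue_on \<Omega>)
      \<or> P / 2 \<le> (\<integral>x. (\<psi> x * c 1 x)\<^sup>2 \<partial>lebesgue_on \<Omega>)"
    by linarith
  then obtain j where "P / 2 \<le> (\<integral>x. (\<psi> x * c j x)\<^sup>2 \<partial>lebesgue_on \<Omega>)" by blast
  then have "k\<^sup>2 / 2 * (P / 2) \<le> k\<^sup>2 / 2 * (\<integral>x. (\<psi> x * c j x)\<^sup>2 \<partial>lebesgue_on \<Omega>)"
    by (intro mult_left_mono) auto
  then have "C \<le> (\<integral>x. (norm (gradient (v j) x))\<^sup>2 \<partial>lebesgue_on \<Omega>)"
    using lower[of j] k by linarith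
  then show ?thesis using v v_bounds by blast
qed

text \<open>Since p > 2, the negative term eventually dominates and brings the function down to a or
  below. At s0 it is at least a, so the intermediate value theorem applies.\<close>

lemma fibering_level:
  fixes N I s0 a p :: real
  assumes p: "p > 2" and I: "I > 0" and s0: "s0 > 0" and a: "a \<le> s0\<^sup>2 / 2 * N - s0 powr p / p * I"
  shows "\<exists>s\<ge>s0. s\<^sup>2 / 2 * N - s powr p / p * I = a"
proof -
  \<comment> \<open>Once s^(p-2) reaches B, the negative term is at least s^2 (|N|/2 + |a|). The
    summand 1 keeps B positive even if N and a are both zero, so that the power can be inverted. The
    bound \<open>s1 \<ge> 1\<close> later gives s1^2 |a| \<ge> |a|.\<close>
  define B where "B = (\<bar>N\<bar> / 2 + \<bar>a\<bar>) * p / I + 1"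
  define s1 where "s1 = max (max s0 1) (B powr (1 / (p - 2)))"
  have B: "B > 0" using p I by (simp add: B_def add_nonneg_pos)
  have s1: "s1 \<ge> 1" "s1 \<ge> s0" "s1 \<ge> B powr (1 / (p - 2))" by (auto simp: s1_def)
  have "B = (B powr (1 / (p - 2))) powr (p - 2)" using B p by (simp add: powr_powr)
  also have "\<dots> \<le> s1 powr (p - 2)" using s1 p by (intro powr_mono2) auto
  finally have "(\<bar>N\<bar> / 2 + \<bar>a\<bar>) * p / I \<le> s1 powr (p - 2)" by (simp add: B_def)
  then have "\<bar>N\<bar> / 2 + \<bar>a\<bar> \<le> s1 powr (p - 2) / p * I" using p I by (simp add: field_simps)
  then have "s1\<^sup>2 * (\<bar>N\<bar> / 2 + \<bar>a\<bar>) \<le> s1\<^sup>2 * (s1 powr (p - 2) / p * I)" by (intro mult_left_mono) auto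
  also have "\<dots> = s1 powr p / p * I"
    using s1 powr_add[of s1 2 "p - 2"] by (simp add: field_simps)
  finally have "s1\<^sup>2 / 2 * N - s1 powr p / p * I \<le> s1\<^sup>2 / 2 * N - s1\<^sup>2 * (\<bar>N\<bar> / 2 + \<bar>a\<bar>)" by simp
  also have "\<dots> = s1\<^sup>2 / 2 * (N - \<bar>N\<bar>) - s1\<^sup>2 * \<bar>a\<bar>" by (simp add: algebra_simps)
  also have "\<dots> \<le> - (1 * \<bar>a\<bar>)"
  proof -
    have "s1\<^sup>2 / 2 * (N - \<bar>N\<bar>) \<le> 0" by (intro mult_nonneg_nonpos) auto
    moreover have "1 * \<bar>a\<bar> \<le> s1\<^sup>2 * \<bar>a\<bar>" using s1 by (intro mult_right_mono) auto
    ultimately show ?thesis by linarith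
  qed
  also have "\<dots> \<le> a" by simp
  finally have "s1\<^sup>2 / 2 * N - s1 powr p / p * I \<le> a" .
  then obtain s where "s0 \<le> s" "s\<^sup>2 / 2 * N - s powr p / p * I = a"
    using IVT2'[of "\<lambda>s. s\<^sup>2 / 2 * N - s powr p / p * I" s1 a s0] a s1 s0 p
    by (force intro!: continuous_intros)
  then show ?thesis by blast
qed

section \<open>Signs of the two constants\<close>

text \<open>Every quotient is nonnegative, so a single admissible function is enough; over the empty
  set the supremum would be -\<infinity>.\<close>

lemma S1_nonneg:
  assumes "H1_vanishing_nonzero \<Omega> \<Gamma>\<^sub>0 \<noteq> {}"
  shows "0 \<le> S1 \<Omega> \<Gamma>\<^sub>0 \<Gamma>\<^sub>1"
proof -
  obtain w where w: "w \<in> H1_vanishing_nonzero \<Omega> \<Gamma>\<^sub>0" using assms by auto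
  have "0 \<le> ereal ((trace_norm \<Omega> \<Gamma>\<^sub>1 w)\<^sup>2) / ereal ((grad_norm \<Omega> w)\<^sup>2)"
    by simp
  also have "\<dots> \<le> S1 \<Omega> \<Gamma>\<^sub>0 \<Gamma>\<^sub>1" unfolding S1_def using w by (rule SUP_upper)
  finally show ?thesis .
qed

text \<open>The quotient of w is positive also when its gradient norm is zero, since it is then
  \<infinity>.\<close>

lemma S2_pos:
  assumes w: "w \<in> H1_vanishing_nonzero \<Omega> \<Gamma>\<^sub>0" and "0 < (Lp_norm 2 (lebesgue_on \<Omega>) w)\<^sup>2"
  shows "0 < S2 \<Omega> \<Gamma>\<^sub>0"
proof -
  have "0 < ereal ((Lp_norm 2 (lebesgue_on \<Omega>) w)\<^sup>2) / ereal ((grad_norm \<Omega> w)\<^sup>2)"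
    using assms(2) by (cases "grad_norm \<Omega> w = 0") (auto simp: zero_less_divide_iff)
  also have "\<dots> \<le> S2 \<Omega> \<Gamma>\<^sub>0" unfolding S2_def using w by (rule SUP_upper)
  finally show ?thesis .
qed

section \<open>Choice of the constants, the oscillating function and the point on its ray\<close>

theorem corollary3p5:
  fixes \<Omega> \<Gamma>\<^sub>0 \<Gamma>\<^sub>1 :: "'a::euclidean_space set" and p a :: real
  assumes "open \<Omega>" and "bounded \<Omega>" and "\<Omega> \<noteq> {}" and "C1_boundary \<Omega>"
    and "\<Gamma>\<^sub>0 \<in> sets (surface_measure \<Omega>)" and "\<Gamma>\<^sub>1 \<in> sets (surface_measure \<Omega>)"
    and "\<Gamma>\<^sub>0 \<union> \<Gamma>\<^sub>1 = frontier \<Omega>" and "\<Gamma>\<^sub>0 \<inter> \<Gamma>\<^sub>1 = {}"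
    and "closure \<Gamma>\<^sub>0 \<inter> closure \<Gamma>\<^sub>1 = {}"
    and "emeasure (surface_measure \<Omega>) \<Gamma>\<^sub>0 > 0"
    and "S1 \<Omega> \<Gamma>\<^sub>0 \<Gamma>\<^sub>1 < \<infinity>" and "S2 \<Omega> \<Gamma>\<^sub>0 < \<infinity>"
    and "2 < p" and "ereal p \<le> 1 + sobolev_exponent DIM('a) / 2"
  shows "J_level \<Omega> \<Gamma>\<^sub>0 p a \<inter> B2 \<Omega> \<Gamma>\<^sub>0 \<Gamma>\<^sub>1 p \<noteq> {}"
proof -
  obtain x0 where x0: "x0 \<in> \<Omega>" using \<open>\<Omega> \<noteq> {}\<close> by auto
  obtain c d where cd: "cbox c d \<subseteq> \<Omega>" "x0 \<in> box c d"
    using open_contains_cbox[OF \<open>open \<Omega>\<close> x0] by metis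
  define \<psi> where "\<psi> = box_bump c d 1"
  have \<psi>: "test_function \<Omega> \<psi>" unfolding \<psi>_def by (intro test_function_box_bump cd) simp
  have \<psi>0: "\<psi> x0 \<noteq> 0" using cd box_bump_nonzero_iff[of 1 c d x0] by (simp add: \<psi>_def)
  have p: "p > 0" using \<open>2 < p\<close> by simp
  note integrable = test_function_powr_integrable[OF \<open>open \<Omega>\<close>]
  define m where "m = (\<integral>x. (\<psi> x)\<^sup>2 \<partial>lebesgue_on \<Omega>)"
  have m: "m > 0"
    using test_function_integral_pos(1)[OF \<open>open \<Omega>\<close> \<psi> \<psi>0, of 2] by (simp add: m_def)

  have \<psi>_nonzero: "\<psi> \<in> H1_vanishing_nonzero \<Omega> \<Gamma>\<^sub>0"
    using test_function_in_H1_vanishing[OF \<open>open \<Omega>\<close> \<psi>]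
      test_function_integral_pos(2)[OF \<open>open \<Omega>\<close> \<psi> \<psi>0 zero_less_one]
    by (simp add: H1_vanishing_nonzero_def)
  have "0 \<le> S1 \<Omega> \<Gamma>\<^sub>0 \<Gamma>\<^sub>1" using \<psi>_nonzero by (intro S1_nonneg) auto
  moreover have "0 < S2 \<Omega> \<Gamma>\<^sub>0"
    using \<psi>_nonzero m by (intro S2_pos) (auto simp: Lp_norm_2_squared m_def)
  \<comment> \<open>\<open>real_of_ereal\<close> maps \<infinity> to 0, so finiteness of both
    constants is what keeps the denominator in \<open>B2\<close> positive.\<close>
  ultimately have S: "0 < real_of_ereal (S1 \<Omega> \<Gamma>\<^sub>0 \<Gamma>\<^sub>1 + S2 \<Omega> \<Gamma>\<^sub>0)"
    using \<open>S1 \<Omega> \<Gamma>\<^sub>0 \<Gamma>\<^sub>1 < \<infinity>\<close> \<open>S2 \<Omega> \<Gamma>\<^sub>0 < \<infinity>\<close>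
    by (cases "S1 \<Omega> \<Gamma>\<^sub>0 \<Gamma>\<^sub>1"; cases "S2 \<Omega> \<Gamma>\<^sub>0") auto
  define \<kappa> where "\<kappa> = (p - 2) / (2 * p * real_of_ereal (S1 \<Omega> \<Gamma>\<^sub>0 \<Gamma>\<^sub>1 + S2 \<Omega> \<Gamma>\<^sub>0))"
  have \<kappa>: "\<kappa> > 0" using S \<open>2 < p\<close> by (simp add: \<kappa>_def)

  \<comment> \<open>The bound \<open>s0 \<ge> 1\<close> gives s0 \<le> s0^2, and then the second
    entry of the maximum yields a < |a| + 1 \<le> \<kappa> m s0^2.\<close>
  define s0 where "s0 = max 1 ((\<bar>a\<bar> + 1) / (\<kappa> * m))"
  have s0: "s0 \<ge> 1" "(\<bar>a\<bar> + 1) / (\<kappa> * m) \<le> s0" by (auto simp: s0_def)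
  have "s0 * 1 \<le> s0 * s0" using s0(1) by (intro mult_left_mono) auto
  then have "(\<bar>a\<bar> + 1) / (\<kappa> * m) \<le> s0\<^sup>2" using s0(2) by (simp add: power2_eq_square)
  then have s0_large: "a < \<kappa> * (s0\<^sup>2 * m)"
    using \<kappa> m by (simp add: pos_divide_le_eq mult_ac)

  \<comment> \<open>This bounds the p-integral of every function dominated by 3|\<psi>|. It is
    available before v is chosen, so the gradient demanded of v can depend on it: the demand is that
    s0^2/2 times the gradient integral be at least a + s0^p R/p.\<close>
  define R where "R = (\<integral>x. (3 * \<bar>\<psi> x\<bar>) powr p \<partial>lebesgue_on \<Omega>)"
  obtain v where v: "test_function \<Omega> v" "\<And>x. \<bar>\<psi> x\<bar> \<le> \<bar>v x\<bar>" "\<And>x. \<bar>v x\<bar> \<le> 3 * \<bar>\<psi> x\<bar>"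
    and v_grad: "2 / s0\<^sup>2 * (a + s0 powr p / p * R) \<le> (\<integral>x. (norm (gradient v x))\<^sup>2 \<partial>lebesgue_on \<Omega>)"
    using oscillating_test_function[OF \<open>open \<Omega>\<close> \<psi> \<psi>0] by blast
  define N where "N = (\<integral>x. (norm (gradient v x))\<^sup>2 \<partial>lebesgue_on \<Omega>)"
  define I where "I = (\<integral>x. \<bar>v x\<bar> powr p \<partial>lebesgue_on \<Omega>)"
  have "v x0 \<noteq> 0" using v(2)[of x0] \<psi>0 by auto
  from test_function_integral_pos(1)[OF \<open>open \<Omega>\<close> v(1) this p] have I: "I > 0" by (simp add: I_def)
  have "I \<le> R"
    unfolding I_def R_def
  proof (rule integral_mono)
    show "integrable (lebesgue_on \<Omega>) (\<lambda>x. (3 * \<bar>\<psi> x\<bar>) powr p)"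
      using integrable[OF \<psi> p] by (simp add: powr_mult)
  qed (use v p integrable[OF v(1) p] in \<open>auto intro: powr_mono2\<close>)
  then have "s0 powr p / p * I \<le> s0 powr p / p * R" using p by (intro mult_left_mono) auto
  moreover have "a + s0 powr p / p * R \<le> s0\<^sup>2 / 2 * N"
    using v_grad s0(1) by (simp add: N_def field_simps)
  ultimately have "a \<le> s0\<^sup>2 / 2 * N - s0 powr p / p * I" by linarith
  then obtain s where s: "s \<ge> s0" "s\<^sup>2 / 2 * N - s powr p / p * I = a"
    using fibering_level[OF \<open>2 < p\<close> I, of s0 a N] s0(1) by auto

  let ?w = "\<lambda>x. v x * s"
  have w: "?w \<in> H1_vanishing \<Omega> \<Gamma>\<^sub>0"
    by (intro test_function_in_H1_vanishing \<open>open \<Omega>\<close> test_function_mult[OF v(1)] Ck_const)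
  have J: "J \<Omega> p ?w = a"
    using J_scaled_test_function[OF \<open>open \<Omega>\<close> v(1) p, of s] s s0(1) by (simp add: N_def I_def)
  \<comment> \<open>From |\<psi>| \<le> |v| and s \<ge> s0, the L^2 norm on the ray has a lower
    bound that depends neither on the oscillation nor on the final s.\<close>
  have "m \<le> (\<integral>x. (v x)\<^sup>2 \<partial>lebesgue_on \<Omega>)"
    unfolding m_def using integrable[OF \<psi>, of 2] integrable[OF v(1), of 2] v(2)
    by (intro integral_mono) (auto simp: abs_le_square_iff)
  then have "s0\<^sup>2 * m \<le> s\<^sup>2 * (\<integral>x. (v x)\<^sup>2 \<partial>lebesgue_on \<Omega>)"
    using s(1) s0(1) m by (intro mult_mono power_mono) auto
  also have "\<dots> = (Lp_norm 2 (lebesgue_on \<Omega>) ?w)\<^sup>2"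
    by (simp add: Lp_norm_2_squared power_mult_distrib mult.commute)
  \<comment> \<open>The boundary term is a square, hence nonnegative for whichever representative
    \<open>trace\<close> picks.\<close>
  also have "\<dots> \<le> (Lp_norm 2 (lebesgue_on \<Omega>) ?w)\<^sup>2 + (trace_norm \<Omega> \<Gamma>\<^sub>1 ?w)\<^sup>2" by simp
  finally have "\<kappa> * (s0\<^sup>2 * m)
      \<le> \<kappa> * ((Lp_norm 2 (lebesgue_on \<Omega>) ?w)\<^sup>2 + (trace_norm \<Omega> \<Gamma>\<^sub>1 ?w)\<^sup>2)"
    using \<kappa> by (intro mult_left_mono) auto
  with s0_large have "?w \<in> B2 \<Omega> \<Gamma>\<^sub>0 \<Gamma>\<^sub>1 p"
    using w J by (simp add: B2_def \<kappa>_def)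
  moreover have "?w \<in> J_level \<Omega> \<Gamma>\<^sub>0 p a"
    using w J by (simp add: J_level_def)
  ultimately show ?thesis by blast
qed

end
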